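(* Let $Z$, $\Theta$, $\Psi$, $G_a$, $G_p$, $Q_a$, $Q_p$ be as in the context, and suppose the following. (A1) For every possible value of the forecast $\hat y$ (i.e. every $\hat y=\Psi(\theta,x)$ with $\theta\in\Theta$, $x\in\mathbb{R}^m$), the planning problem $\min_{z\in Z} G_p(z,\hat y)$ is feasible and has a unique optimal solution $z$. (A2) $Z$ is a non-empty bounded polyhedron. (A3) The feasible set $\{\pi : W_a^\top \pi = q_a,\ \pi\ge 0\}$ of the dual of the linear program defining $Q_a(z,y)$ is non-empty and bounded. (ii) The forecasting function $\Psi(\cdot,\cdot)$ is continuous in both arguments. (iii) The data process $(X_1,Y_1),(X_2,Y_2),\ldots$, with values in $\mathbb{R}^m\times\mathbb{R}^n$, is independent and identically distributed; $(X,Y)$ denotes a generic element. (iv) The random variable $Y$ is integrable. (v) The set $\Theta$ is compact and non-empty. For each $T\ge 1$ let $S_T$ be the set of optimal $\theta$ of the bilevel estimation problem (defined in the context) with data $(x_t,y_t)=(X_t,Y_t)$, $t=1,\dots,T$, and let $\theta_T\in S_T$ be any element. Then, with probability 1, $$\lim_{T\to\infty} d(\theta_T,S^* )=0,$$ where $d$ is the Euclidean distance from a point to a set and $$S^*=\operatorname{argmin}_{\theta\in\Theta}\ \mathbb{E}\big[G_a\big(\zeta(\Psi(\theta,X)),Y\big)\big],\qquad \zeta(y):=\operatorname{argmin}_{z\in Z} G_p(z,y),$$ $\zeta$ being regarded as a vector-valued function since its values are singletons by (A1).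
   Context: Setting: $\Theta$ is a subset of a Euclidean space (parameters), $x\in\mathbb{R}^m$ are features, $y\in\mathbb{R}^n$ is the variable of interest, $\Psi:\Theta\times\mathbb{R}^m\to\mathbb{R}^n$ is the forecasting function, and $Z$ is a subset of a Euclidean space (feasible decisions). For $i\in\{a,p\}$ ($a$ = assessment, $p$ = planning), with fixed vectors $c_i,q_i,b_i$ and matrices $W_i,H_i,F_i$ of compatible dimensions, $$G_i(z,y)=c_i^\top z+Q_i(z,y),\qquad Q_i(z,y)=\min_u\{q_i^\top u \mid W_i u\ge b_i-H_i z+F_i y\},$$ with the convention that $Q_i(z,y)=+\infty$ if the linear program is infeasible. Bilevel estimation problem with data $(x_t,y_t)_{t=1}^T$: $$\min_{\theta\in\Theta,\ \hat y_t,\ z_t^*}\ \frac1T\sum_{t=1}^T G_a(z_t^*,y_t)\quad\text{s.t.}\quad \hat y_t=\Psi(\theta,x_t),\quad z_t^*\in\operatorname{argmin}_{z\in Z}G_p(z,\hat y_t),\quad t=1,\dots,T.$$ $S_T$ denotes the set of the $\theta$-components of its optimal solutions. *)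

theory Defs
  imports "HOL-Probability.Probability"
begin

text \<open>The linear program is a minimisation in the extended reals: the infimum over the empty set is
  \<open>\<infinity>\<close>, an unbounded program has value \<open>-\<infinity>\<close>, and otherwise the infimum is an attained minimum.
  The order on vectors is the componentwise one.\<close>

definition recourse ::
  "real^'u \<Rightarrow> real^'u^'r \<Rightarrow> real^'r \<Rightarrow> real^'d^'r \<Rightarrow> real^'n^'r \<Rightarrow> real^'d \<Rightarrow> real^'n \<Rightarrow> ereal"
  where "recourse q W b H F z y = (INF u \<in> {u. W *v u \<ge> b - H *v z + F *v y}. ereal (q \<bullet> u))"

definition two_stage_cost ::
  "real^'d \<Rightarrow> real^'u \<Rightarrow> real^'u^'r \<Rightarrow> real^'r \<Rightarrow> real^'d^'r \<Rightarrow> real^'n^'r \<Rightarrow> real^'d \<Rightarrow> real^'n \<Rightarrow> ereal"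
  where "two_stage_cost c q W b H F z y = ereal (c \<bullet> z) + recourse q W b H F z y"

text \<open>A problem whose optimal value is \<open>\<infinity>\<close> (infeasible) or \<open>-\<infinity>\<close> (unbounded) has no optimal
  solutions.\<close>

definition argmin_set :: "('a \<Rightarrow> ereal) \<Rightarrow> 'a set \<Rightarrow> 'a set"
  where "argmin_set f C = {x. is_arg_min f (\<lambda>x. x \<in> C) x \<and> \<bar>f x\<bar> \<noteq> \<infinity>}"

definition optimal_decision ::
  "('d \<Rightarrow> 'n \<Rightarrow> ereal) \<Rightarrow> 'd set \<Rightarrow> 'n \<Rightarrow> 'd"
  where "optimal_decision G Z y = the_elem (argmin_set (\<lambda>z. G z y) Z)"

text \<open>The decision variables of the bilevel problem are a parameter, the forecasts and the planned
  decisions; only the entries of the two sequences with index in \<open>{1..T}\<close> matter.\<close>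

definition bilevel_feasible ::
  "('d \<Rightarrow> 'n \<Rightarrow> ereal) \<Rightarrow> 'd set \<Rightarrow> 'p set \<Rightarrow> ('p \<Rightarrow> 'm \<Rightarrow> 'n) \<Rightarrow> (nat \<Rightarrow> 'm) \<Rightarrow> nat
    \<Rightarrow> ('p \<times> (nat \<Rightarrow> 'n) \<times> (nat \<Rightarrow> 'd)) set"
  where "bilevel_feasible Gp Z \<Theta> \<Psi> x T =
    {(\<theta>, yhat, z). \<theta> \<in> \<Theta> \<and>
      (\<forall>t\<in>{1..T}. yhat t = \<Psi> \<theta> (x t) \<and> z t \<in> argmin_set (\<lambda>z'. Gp z' (yhat t)) Z)}"

definition bilevel_objective ::
  "('d \<Rightarrow> 'n \<Rightarrow> ereal) \<Rightarrow> (nat \<Rightarrow> 'n) \<Rightarrow> nat \<Rightarrow> 'p \<times> (nat \<Rightarrow> 'n) \<times> (nat \<Rightarrow> 'd) \<Rightarrow> ereal"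
  where "bilevel_objective Ga y T =
    (\<lambda>(\<theta>, yhat, z). ereal (1 / real T) * (\<Sum>t = 1..T. Ga (z t) (y t)))"

definition bilevel_solutions ::
  "('d \<Rightarrow> 'n \<Rightarrow> ereal) \<Rightarrow> ('d \<Rightarrow> 'n \<Rightarrow> ereal) \<Rightarrow> 'd set \<Rightarrow> 'p set \<Rightarrow> ('p \<Rightarrow> 'm \<Rightarrow> 'n)
    \<Rightarrow> (nat \<Rightarrow> 'm) \<Rightarrow> (nat \<Rightarrow> 'n) \<Rightarrow> nat \<Rightarrow> 'p set"
  where "bilevel_solutions Ga Gp Z \<Theta> \<Psi> x y T =
    fst ` argmin_set (bilevel_objective Ga y T) (bilevel_feasible Gp Z \<Theta> \<Psi> x T)"

text \<open>Expectation of an extended-real random variable: positive part minus negative part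
  (\<open>e2ennreal\<close> truncates negative values to 0).\<close>

definition ereal_expectation :: "'w measure \<Rightarrow> ('w \<Rightarrow> ereal) \<Rightarrow> ereal"
  where "ereal_expectation M f =
    enn2ereal (\<integral>\<^sup>+ \<omega>. e2ennreal (f \<omega>) \<partial>M) - enn2ereal (\<integral>\<^sup>+ \<omega>. e2ennreal (- f \<omega>) \<partial>M)"

lemma ereal_expectation_ereal:
  fixes f :: "'w \<Rightarrow> real"
  assumes "integrable M f"
  shows "ereal_expectation M (\<lambda>\<omega>. ereal (f \<omega>)) = ereal (\<integral>\<omega>. f \<omega> \<partial>M)"
proof -
  have fin: "(\<integral>\<^sup>+ \<omega>. ennreal (f \<omega>) \<partial>M) \<noteq> \<infinity>" "(\<integral>\<^sup>+ \<omega>. ennreal (- f \<omega>) \<partial>M) \<noteq> \<infinity>"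
    using assms real_integrable_def[of M f] by auto
  then obtain a b where ab: "(\<integral>\<^sup>+ \<omega>. ennreal (f \<omega>) \<partial>M) = ennreal a" "a \<ge> 0"
    "(\<integral>\<^sup>+ \<omega>. ennreal (- f \<omega>) \<partial>M) = ennreal b" "b \<ge> 0"
    by (metis ennreal_cases infinity_ennreal_def)
  have "(\<integral>\<omega>. f \<omega> \<partial>M) = a - b"
    using real_lebesgue_integral_def[OF assms] ab by simp
  then show ?thesis
    unfolding ereal_expectation_def using ab
    by (simp add: ennreal.abs_eq[symmetric] enn2ereal_ennreal flip: ennreal.rep_eq)
qed

end

theory Submission
  imports Defs
begin

text \<open>
  The empirical objective is the sample mean of \<open>f \<theta> (X, Y) = G\<^sub>a(\<zeta>(\<Psi>(\<theta>, X)), Y)\<close>, so the claim is a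
  consistency statement for an M-estimator. It needs joint continuity of \<open>f\<close> and an integrable
  envelope.

  Boundedness of the dual feasible set yields, by separation, a vector \<open>u\<close> with \<open>W\<^sub>a u \<ge> 1\<close>; moving
  along \<open>u\<close> repairs any perturbation of the right-hand side, so \<open>Q\<^sub>a\<close> is finite and Lipschitz. This
  gives the envelope \<open>C (1 + \<parallel>Y\<parallel>)\<close>. The map \<open>\<zeta>\<close> is continuous on the set of forecasts: the epigraphs
  of \<open>G\<^sub>p\<close> and of the optimal value are polyhedra, so the optimal value is upper semicontinuous on its
  domain, and limits of minimisers in the compact set \<open>Z\<close> are again minimisers.

  The strong law of large numbers is used only in the one-sided form that the partial sums of an
  i.i.d. sequence with negative mean are almost surely bounded above. Wald's covering argument over
  the compact set \<open>\<Theta>\<close> then rules out estimates away from \<open>S\<^sup>*\<close>.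
\<close>

section \<open>Linear programs with bounded dual feasible set\<close>

text \<open>A nonzero \<open>\<pi> \<ge> 0\<close> with \<open>transpose W *v \<pi> = 0\<close>
  would be a recession direction of the dual feasible set, so boundedness excludes it. Hence
  \<open>transpose W\<close> maps the unit simplex onto a compact convex set that misses 0, and
  strict separation of this set from 0 yields \<open>u\<close> after scaling.\<close>

lemma dual_bounded_imp_strictly_feasible:
  fixes W :: "real^'u^'r" and q :: "real^'u"
  assumes ne: "{\<pi>. transpose W *v \<pi> = q \<and> \<pi> \<ge> 0} \<noteq> {}"
    and bdd: "bounded {\<pi>. transpose W *v \<pi> = q \<and> \<pi> \<ge> 0}"
  shows "\<exists>u. \<forall>i. 1 \<le> (W *v u) $ i"
proof -
  define \<Delta> where "\<Delta> = {\<pi>::real^'r. (\<forall>i. 0 \<le> \<pi> $ i) \<and> (\<Sum>i\<in>UNIV. \<pi> $ i) = 1}"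
  obtain \<pi>\<^sub>0 where \<pi>\<^sub>0: "transpose W *v \<pi>\<^sub>0 = q" "\<pi>\<^sub>0 \<ge> 0"
    using ne by blast
  obtain B where B: "\<And>\<pi>. transpose W *v \<pi> = q \<Longrightarrow> \<pi> \<ge> 0 \<Longrightarrow> norm \<pi> \<le> B"
    using bdd by (auto simp: bounded_iff)
  have "convex \<Delta>"
    by (auto simp: convex_def \<Delta>_def sum.distrib simp flip: sum_distrib_left)
  moreover have "compact \<Delta>"
  proof -
    have "\<Delta> \<subseteq> cbox 0 1"
    proof
      fix \<pi> assume "\<pi> \<in> \<Delta>"
      then have nn: "\<And>i. 0 \<le> \<pi> $ i" and s: "(\<Sum>i\<in>UNIV. \<pi> $ i) = 1"
        by (auto simp: \<Delta>_def)
      have "\<pi> $ i \<le> 1" for i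
        using member_le_sum[of i UNIV "\<lambda>i. \<pi> $ i"] nn s by simp
      with nn show "\<pi> \<in> cbox 0 1"
        by (simp add: mem_box_cart)
    qed
    moreover have "closed \<Delta>"
      unfolding \<Delta>_def
      by (intro closed_Collect_conj closed_Collect_all closed_Collect_le closed_Collect_eq
          continuous_intros)
    ultimately show ?thesis
      by (meson bounded_cbox bounded_subset compact_eq_bounded_closed)
  qed
  ultimately have "convex ((*v) (transpose W) ` \<Delta>)" "closed ((*v) (transpose W) ` \<Delta>)"
    using matrix_vector_mul_linear[of "transpose W"]
    by (blast intro: convex_linear_image compact_imp_closed compact_continuous_image
        linear_continuous_on linear_linear[THEN iffD2])+
  moreover have "0 \<notin> (*v) (transpose W) ` \<Delta>"
  proof
    assume "0 \<in> (*v) (transpose W) ` \<Delta>"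
    then obtain \<pi> where \<pi>: "\<pi> \<in> \<Delta>" "transpose W *v \<pi> = 0"
      by force
    then have "\<pi> \<noteq> 0" and nn: "\<pi> \<ge> 0"
      by (auto simp: \<Delta>_def less_eq_vec_def)
    have "norm (real k *\<^sub>R \<pi>) \<le> 2 * B" for k
    proof -
      have "transpose W *v (\<pi>\<^sub>0 + real k *\<^sub>R \<pi>) = q"
        using \<pi> \<pi>\<^sub>0 by (simp add: matrix_vector_right_distrib matrix_vector_mult_scaleR)
      moreover have "\<pi>\<^sub>0 + real k *\<^sub>R \<pi> \<ge> 0"
        using nn \<pi>\<^sub>0 by (simp add: less_eq_vec_def)
      ultimately have "norm (\<pi>\<^sub>0 + real k *\<^sub>R \<pi>) \<le> B"
        by (rule B)
      moreover have "norm \<pi>\<^sub>0 \<le> B"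
        using B \<pi>\<^sub>0 by blast
      ultimately show ?thesis
        using norm_triangle_ineq4[of "\<pi>\<^sub>0 + real k *\<^sub>R \<pi>" \<pi>\<^sub>0] by simp
    qed
    then have "real k * norm \<pi> \<le> 2 * B" for k
      by simp
    moreover obtain k where "2 * B < real k * norm \<pi>"
      using \<open>\<pi> \<noteq> 0\<close> reals_Archimedean3 zero_less_norm_iff by blast
    ultimately show False
      by (meson not_le)
  qed
  ultimately obtain a b where ab: "0 < b" "\<And>\<pi>. \<pi> \<in> \<Delta> \<Longrightarrow> a \<bullet> (transpose W *v \<pi>) > b"
    by (metis separating_hyperplane_closed_0 imageI)
  have "b < (W *v a) $ i" for i
  proof -
    \<comment> \<open>At the vertices of the simplex the separation reads off the coordinates of
      \<open>W *v a\<close>.\<close>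
    have "axis i 1 \<in> \<Delta>"
      by (simp add: \<Delta>_def axis_def)
    then have "b < a \<bullet> (transpose W *v axis i 1)"
      by (rule ab)
    also have "\<dots> = (W *v a) \<bullet> axis i 1"
      unfolding transpose_matrix_vector by (metis dot_lmul_matrix inner_commute)
    finally show ?thesis
      by (simp add: inner_axis)
  qed
  then have "1 \<le> (W *v ((1 / b) *\<^sub>R a)) $ i" for i
    using \<open>0 < b\<close> by (simp add: matrix_vector_mult_scaleR less_imp_le)
  then show ?thesis
    by blast
qed

text \<open>A dual point \<open>\<pi>\<close> bounds the value from below by weak duality. When the
  right-hand side moves from \<open>w\<close> to \<open>w'\<close>, adding
  \<open>norm (w' - w) *\<^sub>R u\<^sub>1\<close> to a point feasible for \<open>w\<close> makes it
  feasible for \<open>w'\<close> and raises the cost by \<open>norm (w' - w)\<close> times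
  \<open>q \<bullet> u\<^sub>1\<close>, which is therefore a Lipschitz constant.\<close>

lemma lp_value_lipschitz:
  fixes W :: "real^'u^'r" and q :: "real^'u"
  assumes ne: "{\<pi>. transpose W *v \<pi> = q \<and> \<pi> \<ge> 0} \<noteq> {}"
    and bdd: "bounded {\<pi>. transpose W *v \<pi> = q \<and> \<pi> \<ge> 0}"
  obtains \<phi> :: "real^'r \<Rightarrow> real" and L
  where "\<And>w. (INF u\<in>{u. W *v u \<ge> w}. ereal (q \<bullet> u)) = ereal (\<phi> w)" "L-lipschitz_on UNIV \<phi>"
proof -
  obtain u\<^sub>1 where u\<^sub>1: "\<And>i. 1 \<le> (W *v u\<^sub>1) $ i"
    using dual_bounded_imp_strictly_feasible[OF assms] by blast
  obtain \<pi> where \<pi>: "transpose W *v \<pi> = q" "\<pi> \<ge> 0"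
    using ne by blast
  have q: "q \<bullet> u = \<pi> \<bullet> (W *v u)" for u
    using \<pi>(1) by (metis dot_lmul_matrix transpose_matrix_vector)
  have mono: "\<pi> \<bullet> w \<le> \<pi> \<bullet> w'" if "w \<le> w'" for w w'
    using \<pi>(2) that unfolding inner_vec_def less_eq_vec_def
    by (auto intro!: sum_mono mult_left_mono)
  have lower: "\<pi> \<bullet> w \<le> q \<bullet> u" if "W *v u \<ge> w" for u w
    using mono[OF that] by (simp add: q)
  have shift: "W *v (u + norm (w' - w) *\<^sub>R u\<^sub>1) \<ge> w'" if "W *v u \<ge> w" for u w w'
  proof -
    have "w' $ i \<le> (W *v u) $ i + norm (w' - w) * (W *v u\<^sub>1) $ i" for i
    proof -
      have "w' $ i - w $ i \<le> norm (w' - w)"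
        using component_le_norm_cart[of "w' - w" i] by simp
      also have "\<dots> \<le> norm (w' - w) * (W *v u\<^sub>1) $ i"
        using u\<^sub>1[of i] by (simp add: mult_le_cancel_left1)
      finally show ?thesis
        using that by (simp add: less_eq_vec_def) (smt (verit, best))
    qed
    then show ?thesis
      by (simp add: less_eq_vec_def matrix_vector_right_distrib matrix_vector_mult_scaleR)
  qed
  \<comment> \<open>Shifting the point 0, which is feasible for the right-hand side 0, reaches every
    right-hand side.\<close>
  have feasible: "{u. W *v u \<ge> w} \<noteq> {}" for w
    using shift[of 0 0 w] by auto
  define \<phi> where "\<phi> w = (INF u\<in>{u. W *v u \<ge> w}. q \<bullet> u)" for w
  have bdd: "bdd_below ((\<lambda>u. q \<bullet> u) ` {u. W *v u \<ge> w})" for w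
    using lower by (auto intro!: bdd_belowI)
  have "(INF u\<in>{u. W *v u \<ge> w}. ereal (q \<bullet> u)) = ereal (\<phi> w)" for w
    using ereal_Inf'[OF bdd] feasible unfolding \<phi>_def by (simp add: image_image)
  moreover
  have "0 \<le> \<pi> \<bullet> (W *v u\<^sub>1)"
    using mono[of 0 "W *v u\<^sub>1"] u\<^sub>1 by (force simp: less_eq_vec_def intro: order_trans[OF zero_le_one])
  then have L: "0 \<le> q \<bullet> u\<^sub>1"
    by (simp add: q)
  have "\<phi> w' - (q \<bullet> u\<^sub>1) * norm (w' - w) \<le> \<phi> w" for w w'
  proof -
    have "\<phi> w' - (q \<bullet> u\<^sub>1) * norm (w' - w) \<le> q \<bullet> u" if "W *v u \<ge> w" for u
    proof -
      have "\<phi> w' \<le> q \<bullet> (u + norm (w' - w) *\<^sub>R u\<^sub>1)"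
        unfolding \<phi>_def by (rule cINF_lower[OF bdd]) (use shift[OF that] in auto)
      then show ?thesis
        by (simp add: inner_add_right mult.commute)
    qed
    then show ?thesis
      unfolding \<phi>_def[of w] by (intro cINF_greatest[OF feasible]) auto
  qed
  then have "\<bar>\<phi> w - \<phi> w'\<bar> \<le> (q \<bullet> u\<^sub>1) * norm (w - w')" for w w'
    by (smt (verit) norm_minus_commute)
  then have "(q \<bullet> u\<^sub>1)-lipschitz_on UNIV \<phi>"
    using L by (auto simp: lipschitz_on_def dist_norm)
  ultimately show thesis
    by (rule that)
qed

text \<open>The recourse value is a Lipschitz function of \<open>b - H *v z + F *v y\<close>, hence
  continuous and of linear growth. The growth bound becomes an integrable envelope once
  \<open>z\<close> ranges over a bounded set and \<open>y\<close> is an integrable random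
  vector.\<close>

lemma two_stage_cost_continuous:
  fixes c :: "real^'d" and q :: "real^'u" and W :: "real^'u^'r" and b :: "real^'r"
    and H :: "real^'d^'r" and F :: "real^'n^'r"
  assumes ne: "{\<pi>. transpose W *v \<pi> = q \<and> \<pi> \<ge> 0} \<noteq> {}"
    and bdd: "bounded {\<pi>. transpose W *v \<pi> = q \<and> \<pi> \<ge> 0}"
  obtains g C where "\<And>z y. two_stage_cost c q W b H F z y = ereal (g z y)"
    "continuous_on UNIV (\<lambda>(z, y). g z y)" "C \<ge> 0" "\<And>z y. \<bar>g z y\<bar> \<le> C * (1 + norm z + norm y)"
proof -
  obtain \<phi> L where \<phi>: "\<And>w. (INF u\<in>{u. W *v u \<ge> w}. ereal (q \<bullet> u)) = ereal (\<phi> w)"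
    and lip: "L-lipschitz_on UNIV \<phi>"
    using lp_value_lipschitz[OF assms] by metis
  define g where "g z y = c \<bullet> z + \<phi> (b - H *v z + F *v y)" for z y
  have L: "0 \<le> L"
    using lip by (simp add: lipschitz_on_def)
  obtain KH KF where KH: "0 < KH" "\<And>z. norm (H *v z) \<le> KH * norm z"
    and KF: "0 < KF" "\<And>y. norm (F *v y) \<le> KF * norm y"
    by (meson linear_bounded_pos matrix_vector_mul_linear)
  define C where "C = norm c + \<bar>\<phi> 0\<bar> + L * (norm b + KH + KF)"
  show thesis
  proof
    show "two_stage_cost c q W b H F z y = ereal (g z y)" for z y
      by (simp add: two_stage_cost_def recourse_def \<phi> g_def)
    have "continuous_on UNIV \<phi>"
      using lip lipschitz_on_continuous_on by blast
    moreover have "continuous_on UNIV (\<lambda>p. b - H *v fst p + F *v snd p)"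
      by (intro continuous_intros bounded_linear.continuous_on[OF matrix_vector_mul_bounded_linear])
    ultimately have "continuous_on UNIV (\<lambda>p. \<phi> (b - H *v fst p + F *v snd p))"
      by (rule continuous_on_compose2) auto
    then have "continuous_on UNIV (\<lambda>p. c \<bullet> fst p + \<phi> (b - H *v fst p + F *v snd p))"
      by (intro continuous_on_add continuous_on_inner continuous_on_const continuous_on_fst continuous_on_id)
    then show "continuous_on UNIV (\<lambda>(z, y). g z y)"
      by (simp add: g_def case_prod_unfold)
    show "0 \<le> C"
      using L KH KF by (auto simp: C_def intro!: add_nonneg_nonneg mult_nonneg_nonneg)
    fix z :: "real^'d" and y :: "real^'n"
    let ?s = "1 + norm z + norm y"
    have "\<bar>\<phi> w\<bar> \<le> \<bar>\<phi> 0\<bar> + L * norm w" for w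
      using lipschitz_onD[OF lip, of w 0] by (simp add: dist_norm)
    then have "\<bar>\<phi> (b - H *v z + F *v y)\<bar> \<le> \<bar>\<phi> 0\<bar> + L * norm (b - H *v z + F *v y)" .
    also have "\<dots> \<le> \<bar>\<phi> 0\<bar> + L * ((norm b + KH + KF) * ?s)"
    proof (intro add_left_mono mult_left_mono L)
      have "norm (b - H *v z + F *v y) \<le> norm b + KH * norm z + KF * norm y"
        using norm_triangle_ineq[of "b - H *v z" "F *v y"] norm_triangle_ineq4[of b "H *v z"]
          KH(2)[of z] KF(2)[of y] by linarith
      also have "\<dots> \<le> norm b * ?s + KH * ?s + KF * ?s"
        using KH(1) KF(1) by (intro add_mono mult_left_mono) (auto simp: mult_le_cancel_left1)
      finally show "norm (b - H *v z + F *v y) \<le> (norm b + KH + KF) * ?s"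
        by (simp only: distrib_right)
    qed
    finally have "\<bar>\<phi> (b - H *v z + F *v y)\<bar> \<le> \<bar>\<phi> 0\<bar> + L * (norm b + KH + KF) * ?s"
      by (simp only: mult.assoc)
    moreover have "\<bar>\<phi> 0\<bar> * 1 \<le> \<bar>\<phi> 0\<bar> * ?s"
      by (intro mult_left_mono) auto
    moreover have "\<bar>c \<bullet> z\<bar> \<le> norm c * norm z"
      by (rule Cauchy_Schwarz_ineq2)
    moreover have "norm c * norm z \<le> norm c * ?s"
      by (intro mult_left_mono) auto
    ultimately show "\<bar>g z y\<bar> \<le> C * ?s"
      unfolding g_def C_def distrib_right[of _ _ ?s] by linarith
  qed
qed

section \<open>Projections of polyhedra\<close>

text \<open>Unlike in the definition of \<open>polyhedron\<close>, the normals \<open>a\<close> may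
  vanish here. Eliminating a variable or pulling back along a linear map can produce such degenerate
  inequalities.\<close>

lemma polyhedron_system:
  "polyhedron (S :: 'a::euclidean_space set) \<longleftrightarrow> (\<exists>I. finite I \<and> S = {x. \<forall>(a, b)\<in>I. a \<bullet> x \<le> b})"
proof
  assume "polyhedron S"
  then obtain F where F: "finite F" "S = \<Inter>F" "\<forall>h\<in>F. \<exists>a b. a \<noteq> 0 \<and> h = {x. a \<bullet> x \<le> b}"
    unfolding polyhedron_def by blast
  have "\<forall>h\<in>F. \<exists>p. h = {x. fst p \<bullet> x \<le> snd p}"
    using F(3) by force
  from bchoice[OF this] obtain p where p: "\<forall>h\<in>F. h = {x. fst (p h) \<bullet> x \<le> snd (p h)}" ..
  have "S = {x. \<forall>(a, b)\<in>p ` F. a \<bullet> x \<le> b}"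
    unfolding F(2) case_prod_unfold using p by blast
  then show "\<exists>I. finite I \<and> S = {x. \<forall>(a, b)\<in>I. a \<bullet> x \<le> b}"
    using F(1) by blast
next
  assume "\<exists>I. finite I \<and> S = {x. \<forall>(a, b)\<in>I. a \<bullet> x \<le> b}"
  then obtain I where I: "finite I" "S = {x. \<forall>(a, b)\<in>I. a \<bullet> x \<le> b}"
    by blast
  have "S = \<Inter>((\<lambda>(a, b). {x. a \<bullet> x \<le> b}) ` I)"
    using I(2) by auto
  also have "polyhedron \<dots>"
    using I(1) by (intro polyhedron_Inter) (auto simp: polyhedron_halfspace_le)
  finally show "polyhedron S" .
qed

lemma polyhedron_le_linear:
  fixes f :: "'a::euclidean_space \<Rightarrow> real"
  assumes "linear f"
  shows "polyhedron {x. f x \<le> b}"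
proof -
  have "f x = adjoint f 1 \<bullet> x" for x
    using adjoint_works[OF assms, of x 1] by (simp add: inner_commute)
  then show ?thesis
    using polyhedron_halfspace_le[of "adjoint f 1" b] by simp
qed

lemma polyhedron_vimage_linear:
  fixes f :: "'a::euclidean_space \<Rightarrow> 'b::euclidean_space"
  assumes f: "linear f" and S: "polyhedron S"
  shows "polyhedron (f -` S)"
proof -
  obtain I where I: "finite I" "S = {x. \<forall>(a, b)\<in>I. a \<bullet> x \<le> b}"
    using S unfolding polyhedron_system by blast
  have "f -` S = \<Inter>((\<lambda>(a, b). {x. a \<bullet> f x \<le> b}) ` I)"
    using I(2) by auto
  also have "polyhedron \<dots>"
    using I(1) linear_compose[OF f bounded_linear.linear[OF bounded_linear_inner_right]]
    by (intro polyhedron_Inter) (auto simp: comp_def intro!: polyhedron_le_linear)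
  finally show ?thesis .
qed

text \<open>Fourier--Motzkin elimination of the coordinate along \<open>e\<close>: the upper bounds on \<open>t\<close> must
  dominate the lower ones.\<close>

lemma polyhedron_sweep_direction:
  fixes S :: "'a::euclidean_space set"
  assumes "polyhedron S"
  shows "polyhedron {x. \<exists>t. x + t *\<^sub>R e \<in> S}"
proof -
  obtain I where I: "finite I" "S = {x. \<forall>(a, b)\<in>I. a \<bullet> x \<le> b}"
    using assms unfolding polyhedron_system by blast
  define Pos where "Pos = {(a, b)\<in>I. a \<bullet> e > 0}"
  define Neg where "Neg = {(a, b)\<in>I. a \<bullet> e < 0}"
  define Zero where "Zero = {(a, b)\<in>I. a \<bullet> e = 0}"
  have fin: "finite Pos" "finite Neg" "finite Zero"
    using I(1) by (auto simp: Pos_def Neg_def Zero_def intro: finite_subset)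
  \<comment> \<open>Along \<open>x + t *\<^sub>R e\<close>, the inequality \<open>p\<close> becomes
    tight at \<open>t = r p x\<close>: an upper bound on \<open>t\<close> for \<open>p\<close> in
    \<open>Pos\<close>, a lower bound for \<open>p\<close> in \<open>Neg\<close>.\<close>
  define r where "r p x = (snd p - fst p \<bullet> x) / (fst p \<bullet> e)" for p and x :: 'a
  \<comment> \<open>Each pair of an upper and a lower bound contributes the condition
    \<open>r p' x \<le> r p x\<close>, rearranged into a linear inequality in
    \<open>x\<close>.\<close>
  define J where "J = (\<lambda>((a, b), (a', b')). (a' /\<^sub>R (- (a' \<bullet> e)) + a /\<^sub>R (a \<bullet> e),
      b' / (- (a' \<bullet> e)) + b / (a \<bullet> e))) ` (Pos \<times> Neg)"
  have mem: "x + t *\<^sub>R e \<in> S \<longleftrightarrow>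
      (\<forall>(a, b)\<in>Zero. a \<bullet> x \<le> b) \<and> (\<forall>p\<in>Pos. t \<le> r p x) \<and> (\<forall>p\<in>Neg. r p x \<le> t)" for x t
  proof -
    have "a \<bullet> (x + t *\<^sub>R e) \<le> b \<longleftrightarrow> t \<le> r (a, b) x" if "a \<bullet> e > 0" for a b
      using that by (auto simp: r_def inner_add_right field_simps)
    moreover have "a \<bullet> (x + t *\<^sub>R e) \<le> b \<longleftrightarrow> r (a, b) x \<le> t" if "a \<bullet> e < 0" for a b
      using that by (auto simp: r_def inner_add_right field_simps)
    moreover have "a \<bullet> (x + t *\<^sub>R e) \<le> b \<longleftrightarrow> a \<bullet> x \<le> b" if "a \<bullet> e = 0" for a b
      using that by (simp add: inner_add_right)
    moreover have "a \<bullet> e > 0 \<or> a \<bullet> e < 0 \<or> a \<bullet> e = 0" for a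
      by linarith
    ultimately show ?thesis
      unfolding I(2) Pos_def Neg_def Zero_def by fastforce
  qed
  have between: "(\<exists>t. (\<forall>p\<in>Pos. t \<le> r p x) \<and> (\<forall>p\<in>Neg. r p x \<le> t)) \<longleftrightarrow>
      (\<forall>p\<in>Pos. \<forall>p'\<in>Neg. r p' x \<le> r p x)" (is "?l \<longleftrightarrow> ?r") for x
  proof
    assume ?r
    show ?l
    proof (cases "Neg = {}")
      case True
      \<comment> \<open>Without lower bounds any \<open>t\<close> below all upper bounds works; the
        inserted 0 keeps the minimum defined if \<open>Pos\<close> is empty too.\<close>
      show ?thesis
        using fin(1) by (intro exI[of _ "Min (insert 0 ((\<lambda>p. r p x) ` Pos))"]) (auto simp: True)
    next
      case False
      with \<open>?r\<close> fin show ?thesis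
        by (intro exI[of _ "Max ((\<lambda>p. r p x) ` Neg)"]) auto
    qed
  qed (blast intro: order_trans)
  have J: "(\<forall>p\<in>Pos. \<forall>p'\<in>Neg. r p' x \<le> r p x) \<longleftrightarrow> (\<forall>(a, b)\<in>J. a \<bullet> x \<le> b)" for x
  proof -
    have "r (a', b') x \<le> r (a, b) x \<longleftrightarrow>
        (a' /\<^sub>R (- (a' \<bullet> e)) + a /\<^sub>R (a \<bullet> e)) \<bullet> x \<le> b' / (- (a' \<bullet> e)) + b / (a \<bullet> e)" for a b a' b'
      by (simp add: r_def inner_add_left diff_divide_distrib divide_inverse) (auto simp: algebra_simps)
    then show ?thesis
      unfolding J_def by fastforce
  qed
  have "{x. \<exists>t. x + t *\<^sub>R e \<in> S} = {x. \<forall>(a, b)\<in>Zero \<union> J. a \<bullet> x \<le> b}"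
    unfolding mem using between J by (auto simp: ball_Un)
  moreover have "finite (Zero \<union> J)"
    using fin by (auto simp: J_def)
  ultimately show ?thesis
    unfolding polyhedron_system by blast
qed

text \<open>Sweeping along the generators one at a time reduces this to the elimination of a single
  direction.\<close>

lemma polyhedron_sweep_span:
  fixes S :: "'a::euclidean_space set"
  assumes "finite B" "polyhedron S"
  shows "polyhedron {x. \<exists>v\<in>span B. x + v \<in> S}"
  using assms
proof (induction B arbitrary: S rule: finite_induct)
  case (insert e B)
  have "{x. \<exists>v\<in>span (insert e B). x + v \<in> S} = {x. \<exists>v\<in>span B. x + v \<in> {x. \<exists>t. x + t *\<^sub>R e \<in> S}}"
  proof safe
    fix x v assume "v \<in> span (insert e B)" "x + v \<in> S"
    then obtain k where "v - k *\<^sub>R e \<in> span B"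
      unfolding span_insert by blast
    with \<open>x + v \<in> S\<close> show "\<exists>v\<in>span B. x + v \<in> {x. \<exists>t. x + t *\<^sub>R e \<in> S}"
      by (intro bexI[of _ "v - k *\<^sub>R e"]) (auto intro!: exI[of _ k])
  next
    fix x v t assume "v \<in> span B" "x + v + t *\<^sub>R e \<in> S"
    then show "\<exists>v\<in>span (insert e B). x + v \<in> S"
      by (intro bexI[of _ "v + t *\<^sub>R e"])
        (auto simp: add.assoc intro!: span_add span_scale intro: span_base span_mono[THEN subsetD])
  qed
  then show ?case
    using insert.IH[OF polyhedron_sweep_direction[OF insert.prems, of e]] by simp
qed simp

text \<open>The point \<open>(x, 0)\<close> can be moved into \<open>S\<close> along the span of the
  vectors \<open>(0, u)\<close> exactly if some \<open>(x, u)\<close> lies in \<open>S\<close>, so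
  the projection is a linear preimage of a sweep.\<close>

lemma polyhedron_projection:
  fixes S :: "('a::euclidean_space \<times> 'b::euclidean_space) set"
  assumes "polyhedron S"
  shows "polyhedron {x. \<exists>u. (x, u) \<in> S}"
proof -
  have lin: "linear (\<lambda>x::'a. (x, 0::'b))" "linear (\<lambda>u::'b. (0::'a, u))"
    by (auto intro!: linearI)
  have "span ((\<lambda>u. (0::'a, u::'b)) ` Basis) = (\<lambda>u. (0, u)) ` UNIV"
    using span_linear_image[OF lin(2), of Basis] by simp
  then have "{x. \<exists>u. (x, u) \<in> S} = (\<lambda>x. (x, 0)) -` {x. \<exists>v\<in>span ((\<lambda>u. (0, u)) ` Basis). x + v \<in> S}"
    by auto
  also have "polyhedron \<dots>"
    using assms by (intro polyhedron_vimage_linear lin polyhedron_sweep_span) auto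
  finally show ?thesis .
qed

section \<open>Continuity of the optimal decision\<close>

lemma polyhedron_Collect_conj:
  "polyhedron {x. P x} \<Longrightarrow> polyhedron {x. Q x} \<Longrightarrow> polyhedron {x::'a::euclidean_space. P x \<and> Q x}"
  by (simp add: Collect_conj_eq)

lemma polyhedron_Collect_all:
  fixes P :: "'i::finite \<Rightarrow> 'a::euclidean_space \<Rightarrow> bool"
  assumes "\<And>i. polyhedron {x. P i x}"
  shows "polyhedron {x. \<forall>i. P i x}"
  unfolding Collect_all_eq using assms by (intro polyhedron_Inter) auto

lemma argmin_set_eq_optimal_decision:
  assumes "\<exists>!z. z \<in> argmin_set (\<lambda>z. G z y) Z"
  shows "argmin_set (\<lambda>z. G z y) Z = {optimal_decision G Z y}"
  using assms unfolding optimal_decision_def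
  by (metis (full_types) is_singletonI' is_singleton_the_elem ex_in_conv)

context
  fixes c :: "real^'d" and q :: "real^'u" and W :: "real^'u^'r" and b :: "real^'r"
    and H :: "real^'d^'r" and F :: "real^'n^'r" and Z :: "(real^'d) set"
  assumes Z: "polyhedron Z"
begin

text \<open>The recourse \<open>u\<close> is an explicit witness, so the set is the projection of a
  polyhedron. It contains the strict epigraph of the cost over \<open>Z\<close> and lies inside the
  epigraph; this sandwich suffices for the limit arguments and leaves attainment of the infimum over
  \<open>u\<close> aside.\<close>

definition cost_epigraph :: "(((real^'d) \<times> (real^'n)) \<times> real) set" where
  "cost_epigraph = {p. \<exists>u. fst (fst p) \<in> Z \<and> W *v u \<ge> b - H *v fst (fst p) + F *v snd (fst p) \<and>
     c \<bullet> fst (fst p) + q \<bullet> u \<le> snd p}"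

lemma polyhedron_cost_epigraph: "polyhedron cost_epigraph"
proof -
  define R where "R = {r :: (((real^'d) \<times> (real^'n)) \<times> real) \<times> (real^'u).
    fst (fst (fst r)) \<in> Z \<and>
    (\<forall>i. (F *v snd (fst (fst r)) - H *v fst (fst (fst r)) - W *v snd r) $ i \<le> - b $ i) \<and>
    c \<bullet> fst (fst (fst r)) + q \<bullet> snd r - snd (fst r) \<le> 0}"
  have "linear (\<lambda>r :: (((real^'d) \<times> (real^'n)) \<times> real) \<times> (real^'u). fst (fst (fst r)))"
    by (rule linearI) auto
  from polyhedron_vimage_linear[OF this Z]
  have "polyhedron {r :: (((real^'d) \<times> (real^'n)) \<times> real) \<times> (real^'u). fst (fst (fst r)) \<in> Z}"
    by (simp add: vimage_def)
  then have "polyhedron R"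
    unfolding R_def
    by (intro polyhedron_Collect_conj polyhedron_Collect_all polyhedron_le_linear linearI)
      (auto simp: matrix_vector_right_distrib matrix_vector_mult_scaleR algebra_simps)
  moreover have "cost_epigraph = {p. \<exists>u. (p, u) \<in> R}"
    unfolding cost_epigraph_def R_def less_eq_vec_def by (auto simp: algebra_simps)
  ultimately show ?thesis
    using polyhedron_projection by simp
qed

lemma cost_epigraphD:
  "((z, y), t) \<in> cost_epigraph \<Longrightarrow> z \<in> Z \<and> two_stage_cost c q W b H F z y \<le> ereal t"
proof -
  assume "((z, y), t) \<in> cost_epigraph"
  then obtain u where u: "z \<in> Z" "W *v u \<ge> b - H *v z + F *v y" "c \<bullet> z + q \<bullet> u \<le> t"
    by (auto simp: cost_epigraph_def)
  then have "recourse q W b H F z y \<le> ereal (q \<bullet> u)"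
    unfolding recourse_def by (intro INF_lower) simp
  then have "two_stage_cost c q W b H F z y \<le> ereal (c \<bullet> z) + ereal (q \<bullet> u)"
    unfolding two_stage_cost_def by (rule add_left_mono)
  also have "\<dots> \<le> ereal t"
    using u by simp
  finally show ?thesis
    using u by simp
qed

lemma cost_epigraphI:
  assumes "z \<in> Z" "two_stage_cost c q W b H F z y < ereal t"
  shows "((z, y), t) \<in> cost_epigraph"
proof -
  have "recourse q W b H F z y < ereal (t - c \<bullet> z)"
    using assms(2) unfolding two_stage_cost_def by (cases "recourse q W b H F z y") auto
  then obtain u where "W *v u \<ge> b - H *v z + F *v y" "q \<bullet> u < t - c \<bullet> z"
    unfolding recourse_def INF_less_iff by auto
  then show ?thesis
    using assms(1) by (auto simp: cost_epigraph_def intro!: exI[of _ u])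
qed

text \<open>The value function of the parametric program has a polyhedral epigraph. Its inequalities with
  a negative coefficient of \<open>t\<close> become strict when \<open>t\<close> is raised above the optimal value, hence
  persist nearby, and those with coefficient 0 hold on all of the domain.\<close>

lemma optimal_value_upper_semicontinuous:
  fixes V :: "real^'n \<Rightarrow> real"
  assumes attained: "\<And>y. y \<in> D \<Longrightarrow> \<exists>z\<in>Z. two_stage_cost c q W b H F z y = ereal (V y)"
    and minimal: "\<And>y z. y \<in> D \<Longrightarrow> z \<in> Z \<Longrightarrow> ereal (V y) \<le> two_stage_cost c q W b H F z y"
    and y: "y \<in> D" and s: "\<And>n. s n \<in> D" "s \<longlonglongrightarrow> y" and e: "0 < e"
  shows "\<forall>\<^sub>F n in sequentially. V (s n) \<le> V y + e"
proof -
  \<comment> \<open>Projecting \<open>z\<close> away as well leaves a polyhedron that, over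
    \<open>D\<close>, lies between the strict epigraph and the epigraph of \<open>V\<close>.\<close>
  define E where "E = {p. \<exists>z. ((z, fst p), snd p) \<in> cost_epigraph}"
  have "linear (\<lambda>r :: ((real^'n) \<times> real) \<times> (real^'d). ((snd r, fst (fst r)), snd (fst r)))"
    by (rule linearI) auto
  from polyhedron_vimage_linear[OF this polyhedron_cost_epigraph] have "polyhedron E"
    unfolding E_def
    by (intro polyhedron_projection[of "(\<lambda>r. ((snd r, fst (fst r)), snd (fst r))) -` cost_epigraph", simplified])
  then obtain I where I: "finite I" "E = {x. \<forall>(a, \<beta>)\<in>I. a \<bullet> x \<le> \<beta>}"
    unfolding polyhedron_system by blast
  have E_D: "V y \<le> t" if E_mem: "(y, t) \<in> E" and "y \<in> D" for y t
  proof -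
    obtain z where "((z, y), t) \<in> cost_epigraph"
      using E_mem by (auto simp: E_def)
    then have "z \<in> Z" "two_stage_cost c q W b H F z y \<le> ereal t"
      using cost_epigraphD by blast+
    with minimal[OF \<open>y \<in> D\<close>] have "ereal (V y) \<le> ereal t"
      using order_trans by blast
    then show ?thesis
      by simp
  qed
  have E_I: "(y, t) \<in> E" if "V y < t" "y \<in> D" for y t
    using attained[OF that(2)] that(1) by (auto simp: E_def intro!: cost_epigraphI)
  have E_ineq: "a \<bullet> y + r * t \<le> \<beta>" if "(y, t) \<in> E" "((a, r), \<beta>) \<in> I" for y t a r \<beta>
    using that unfolding I(2) by force
  have "\<forall>\<^sub>F n in sequentially. a \<bullet> s n + r * (V y + e) \<le> \<beta>" if I_mem: "((a, r), \<beta>) \<in> I" for a r \<beta>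
  proof -
    consider "r < 0" | "r = 0" | "r > 0"
      by linarith
    then show ?thesis
    proof cases
      case 1
      have "r * (V y + e) < r * (V y + e / 2)"
        using 1 e by simp
      moreover have "a \<bullet> y + r * (V y + e / 2) \<le> \<beta>"
        using E_I y e I_mem by (intro E_ineq) auto
      ultimately have less: "a \<bullet> y + r * (V y + e) < \<beta>"
        by linarith
      have "(\<lambda>n. a \<bullet> s n + r * (V y + e)) \<longlonglongrightarrow> a \<bullet> y + r * (V y + e)"
        by (intro tendsto_intros s)
      from order_tendstoD(2)[OF this less] show ?thesis
        by eventually_elim simp
    next
      case 2
      \<comment> \<open>The summand 1 puts the point strictly above the graph of \<open>V\<close>,
        hence into \<open>E\<close>; with \<open>r = 0\<close> the height drops out.\<close>
      have "a \<bullet> s n + r * (V (s n) + 1) \<le> \<beta>" for n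
        using E_I s I_mem by (intro E_ineq) auto
      then show ?thesis
        by (simp add: 2)
    next
      case 3
      \<comment> \<open>This case is contradictory: \<open>E\<close> contains all points above
        \<open>V y\<close>, and with a positive coefficient the inequality fails at large
        heights.\<close>
      obtain k :: nat where k: "\<beta> - a \<bullet> y - r * V y < real k * r"
        using reals_Archimedean3[OF 3] by blast
      have "a \<bullet> y + r * (V y + real (Suc k)) \<le> \<beta>"
        using E_I y I_mem by (intro E_ineq) auto
      then show ?thesis
        using k 3 by (simp add: algebra_simps)
    qed
  qed
  then have "\<forall>\<^sub>F n in sequentially. \<forall>(a, \<beta>)\<in>I. a \<bullet> (s n, V y + e) \<le> \<beta>"
    by (intro eventually_ball_finite I) (auto simp: case_prod_unfold inner_prod_def)
  then show ?thesis
  proof eventually_elim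
    case (elim n)
    then show ?case
      using E_D s(1) unfolding I(2) by blast
  qed
qed

text \<open>Decisions lie in the compact set \<open>Z\<close>, so a closed graph implies continuity.
  If forecasts and their decisions converge, upper semicontinuity of the optimal value puts the
  limit into the closed set \<open>cost_epigraph\<close> at every height above the optimal value.
  The limit decision is thus optimal, and uniqueness identifies it.\<close>

lemma optimal_decision_continuous_on:
  assumes "bounded Z"
    and unique: "\<And>y. y \<in> D \<Longrightarrow> \<exists>!z. z \<in> argmin_set (\<lambda>z. two_stage_cost c q W b H F z y) Z"
  shows "continuous_on D (optimal_decision (two_stage_cost c q W b H F) Z)"
proof -
  define G where "G = two_stage_cost c q W b H F"
  define \<zeta> where "\<zeta> = optimal_decision G Z"
  define V where "V y = real_of_ereal (G (\<zeta> y) y)" for y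
  have argmin: "argmin_set (\<lambda>z. G z y) Z = {\<zeta> y}" if "y \<in> D" for y
    using argmin_set_eq_optimal_decision[where G = "two_stage_cost c q W b H F", OF unique[OF that]] by (simp add: \<zeta>_def G_def)
  have \<zeta>: "\<zeta> y \<in> Z" "\<bar>G (\<zeta> y) y\<bar> \<noteq> \<infinity>" "\<And>z. z \<in> Z \<Longrightarrow> G (\<zeta> y) y \<le> G z y" if "y \<in> D" for y
  proof -
    have "\<zeta> y \<in> argmin_set (\<lambda>z. G z y) Z"
      using argmin[OF that] by simp
    then show "\<zeta> y \<in> Z" "\<bar>G (\<zeta> y) y\<bar> \<noteq> \<infinity>" "\<And>z. z \<in> Z \<Longrightarrow> G (\<zeta> y) y \<le> G z y"
      by (auto simp: argmin_set_def is_arg_min_def not_less)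
  qed
  have V: "G (\<zeta> y) y = ereal (V y)" if "y \<in> D" for y
    using \<zeta>(2)[OF that] by (simp add: V_def ereal_real)
  have min: "ereal (V y) \<le> G z y" if "y \<in> D" "z \<in> Z" for y z
    using \<zeta>(3)[OF that] V[OF that(1)] by simp
  have "compact Z"
    using Z \<open>bounded Z\<close> polyhedron_imp_closed compact_eq_bounded_closed by blast
  have limit: "z = \<zeta> y"
    if y: "y \<in> D" and z: "z \<in> Z" and s: "\<And>n. s n \<in> D" "s \<longlonglongrightarrow> y" "(\<lambda>n. \<zeta> (s n)) \<longlonglongrightarrow> z" for y z s
  proof -
    have "G z y \<le> ereal (V y) + ereal e" if "0 < e" for e
    proof -
      \<comment> \<open>Half of \<open>e\<close> is spent on semicontinuity; the other half provides
        the strict inequality that \<open>cost_epigraphI\<close> requires.\<close>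
      have "\<forall>\<^sub>F n in sequentially. V (s n) \<le> V y + e / 2"
        by (rule optimal_value_upper_semicontinuous[where D = D])
          (use \<zeta>(1) V min y s \<open>0 < e\<close> in \<open>auto simp flip: G_def\<close>)
      then have "\<forall>\<^sub>F n in sequentially. ((\<zeta> (s n), s n), V y + e) \<in> cost_epigraph"
        by eventually_elim (use \<zeta>(1) V s \<open>0 < e\<close> in \<open>auto intro!: cost_epigraphI simp flip: G_def\<close>)
      moreover have "(\<lambda>n. ((\<zeta> (s n), s n), V y + e)) \<longlonglongrightarrow> ((z, y), V y + e)"
        by (intro tendsto_intros s)
      ultimately have "((z, y), V y + e) \<in> cost_epigraph"
        by (intro Lim_in_closed_set[OF polyhedron_imp_closed[OF polyhedron_cost_epigraph]]) auto
      then show ?thesis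
        using cost_epigraphD by (simp add: G_def)
    qed
    then have "G z y \<le> ereal (V y)"
      by (rule ereal_le_epsilon2)
    then have "G z y = ereal (V y)"
      using min[OF y z] by simp
    then have "z \<in> argmin_set (\<lambda>z. G z y) Z"
      using min[OF y] z by (auto simp: argmin_set_def is_arg_min_def not_less)
    then show ?thesis
      using argmin[OF y] by simp
  qed
  let ?graph = "(\<lambda>y. (y, \<zeta> y)) ` D"
  \<comment> \<open>The set \<open>D\<close> need not be closed, so closedness of the graph is shown
    relative to \<open>D \<times> Z\<close>.\<close>
  have "?graph = (D \<times> Z) \<inter> closure ?graph"
  proof
    show "?graph \<subseteq> (D \<times> Z) \<inter> closure ?graph"
      using \<zeta>(1) closure_subset[of ?graph] by auto
    show "(D \<times> Z) \<inter> closure ?graph \<subseteq> ?graph"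
    proof safe
      fix y z assume yz: "y \<in> D" "z \<in> Z" "(y, z) \<in> closure ?graph"
      then obtain p where p: "\<And>n. p n \<in> ?graph" "p \<longlonglongrightarrow> (y, z)"
        unfolding closure_sequential by blast
      have snd_p: "snd (p n) = \<zeta> (fst (p n))" "fst (p n) \<in> D" for n
        using p(1)[of n] by auto
      have "z = \<zeta> y"
        using tendsto_fst[OF p(2)] tendsto_snd[OF p(2)] snd_p yz
        by (intro limit[where s = "\<lambda>n. fst (p n)"]) auto
      then show "(y, z) \<in> ?graph"
        using yz by blast
    qed
  qed
  then have "closedin (top_of_set (D \<times> Z)) ?graph"
    using closedin_closed closed_closure by blast
  then have "continuous_on D \<zeta>"
    using continuous_closed_graph_eq[OF \<open>compact Z\<close>, of \<zeta> D] \<zeta>(1) by blast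
  then show ?thesis
    by (simp add: \<zeta>_def G_def)
qed

end

section \<open>A one-sided strong law of large numbers\<close>

text \<open>The largest of the partial sums of lengths 0 to \<open>n\<close>. Recursion at the first
  term instead of the last matches the splitting of a sequence into head and shifted tail by
  \<open>case_nat\<close>.\<close>

fun running_max :: "(nat \<Rightarrow> real) \<Rightarrow> nat \<Rightarrow> real" where
  "running_max x 0 = 0"
| "running_max x (Suc n) = max 0 (x 0 + running_max (\<lambda>i. x (Suc i)) n)"

lemma running_max_nonneg: "0 \<le> running_max x n"
  by (cases n) auto

lemma running_max_le_sum_abs: "running_max x n \<le> (\<Sum>i<n. \<bar>x i\<bar>)"
proof (induction n arbitrary: x)
  case (Suc n)
  show ?case
    using Suc[of "\<lambda>i. x (Suc i)"] by (simp add: sum.lessThan_Suc_shift sum_nonneg del: sum.lessThan_Suc)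
qed simp

lemma sum_le_running_max: "(\<Sum>i<n. x i) \<le> running_max x n"
proof (induction n arbitrary: x)
  case (Suc n)
  show ?case
    using Suc[of "\<lambda>i. x (Suc i)"] by (simp add: sum.lessThan_Suc_shift del: sum.lessThan_Suc)
qed simp

lemma running_max_mono_Suc: "running_max x n \<le> running_max x (Suc n)"
proof (induction n arbitrary: x)
  case (Suc n)
  show ?case
    using Suc[of "\<lambda>i. x (Suc i)"] by simp
qed simp

context sequence_space
begin

lemma integrable_component:
  fixes h :: "'a \<Rightarrow> real"
  assumes "integrable M h"
  shows "integrable S (\<lambda>\<omega>. h (\<omega> i))"
proof -
  have "integrable (distr S M (\<lambda>\<omega>. \<omega> i)) h"
    using assms PiM_component[of i] by simp
  then show ?thesis
    by (subst (asm) integrable_distr_eq) (use assms in auto)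
qed

lemma measurable_running_max [measurable]:
  fixes h :: "'a \<Rightarrow> real"
  assumes [measurable]: "h \<in> borel_measurable M"
  shows "(\<lambda>\<omega>. running_max (\<lambda>i. h (\<omega> i)) n) \<in> borel_measurable S"
proof -
  \<comment> \<open>The recursion shifts the sequence, so the induction needs an arbitrary offset
    \<open>k\<close>.\<close>
  have "(\<lambda>\<omega>. running_max (\<lambda>i. h (\<omega> (i + k))) n) \<in> borel_measurable S" for k
  proof (induction n arbitrary: k)
    case (Suc n)
    have [measurable]: "(\<lambda>\<omega>. running_max (\<lambda>i. h (\<omega> (Suc (i + k)))) n) \<in> borel_measurable S"
      using Suc[of "Suc k"] by simp
    show ?case
      by simp
  qed simp
  from this[of 0] show ?thesis
    by simp
qed

lemma integrable_running_max:
  fixes h :: "'a \<Rightarrow> real"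
  assumes "integrable M h"
  shows "integrable S (\<lambda>\<omega>. running_max (\<lambda>i. h (\<omega> i)) n)"
proof (rule Bochner_Integration.integrable_bound)
  show "integrable S (\<lambda>\<omega>. \<Sum>i<n. \<bar>h (\<omega> i)\<bar>)"
    using assms by (intro Bochner_Integration.integrable_sum integrable_abs integrable_component)
  show "(\<lambda>\<omega>. running_max (\<lambda>i. h (\<omega> i)) n) \<in> borel_measurable S"
    using assms by measurable
  show "AE \<omega> in S. norm (running_max (\<lambda>i. h (\<omega> i)) n) \<le> norm (\<Sum>i<n. \<bar>h (\<omega> i)\<bar>)"
    by (simp add: running_max_nonneg running_max_le_sum_abs sum_nonneg)
qed

text \<open>With \<open>m\<^sub>n\<close> the running maximum and \<open>m'\<^sub>n\<close> its shift, \<open>m\<^sub>n\<^sub>+\<^sub>1 - m'\<^sub>n = max (- m'\<^sub>n) h\<close> has nonnegative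
  mean on the shift-invariant event \<open>A\<close> that the maxima diverge, by stationarity and monotonicity.
  On \<open>A\<close> it tends to \<open>h\<close>, dominated by \<open>\<bar>h\<bar>\<close>, and \<open>h\<close> is independent of the shift, so
  \<open>E h \<cdot> P(A) \<ge> 0\<close>.\<close>

lemma AE_bdd_above_partial_sums:
  fixes h :: "'a \<Rightarrow> real"
  assumes h: "integrable M h" and neg: "(\<integral>x. h x \<partial>M) < 0"
  shows "AE \<omega> in S. bdd_above (range (\<lambda>n. \<Sum>i<n. h (\<omega> i)))"
proof -
  interpret pair_sigma_finite M S ..
  interpret MS: prob_space "M \<Otimes>\<^sub>M S"
    by (intro prob_space_pair prob_space_axioms M.prob_space_axioms)
  define m where "m n \<omega> = running_max (\<lambda>i. h (\<omega> i)) n" for n and \<omega> :: "nat \<Rightarrow> 'a"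
  define A where "A = {\<omega> \<in> space S. \<forall>k::nat. \<exists>n. real k < m n \<omega>}"
  have [measurable]: "h \<in> borel_measurable M"
    using h by simp
  have m_meas [measurable]: "m n \<in> borel_measurable S" for n
    unfolding m_def by measurable
  have m_int: "integrable S (m n)" for n
    unfolding m_def by (rule integrable_running_max[OF h])
  have A_sets [measurable]: "A \<in> sets S"
    unfolding A_def by measurable
  have m_Suc: "m (Suc n) (case_nat x \<omega>) = max 0 (h x + m n \<omega>)" for n x \<omega>
    by (simp add: m_def)
  have m_nonneg: "0 \<le> m n \<omega>" for n \<omega>
    by (simp add: m_def running_max_nonneg)
  have m_mono: "incseq (\<lambda>n. m n \<omega>)" for \<omega>
    unfolding m_def by (rule incseq_SucI) (rule running_max_mono_Suc)
  \<comment> \<open>Prepending \<open>x\<close> changes the maxima by at most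
    \<open>\<bar>h x\<bar>\<close> and the index by one, which preserves divergence in both
    directions.\<close>
  have A_shift: "case_nat x \<omega> \<in> A \<longleftrightarrow> \<omega> \<in> A" if "x \<in> space M" "\<omega> \<in> space S" for x \<omega>
  proof -
    have "(\<forall>k::nat. \<exists>n. real k < m n (case_nat x \<omega>)) \<longleftrightarrow> (\<forall>k::nat. \<exists>n. real k < m n \<omega>)"
    proof safe
      fix k :: nat assume *: "\<forall>k::nat. \<exists>n. real k < m n (case_nat x \<omega>)"
      obtain k' :: nat where k': "real k + \<bar>h x\<bar> \<le> real k'"
        using real_arch_simple by blast
      obtain n where n: "real k' < m n (case_nat x \<omega>)"
        using * by blast
      also have "\<dots> \<le> m (Suc n) (case_nat x \<omega>)"
        using m_mono by (rule incseq_SucD)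
      finally have "real k < m n \<omega>"
        using k' by (simp add: m_Suc split: if_splits)
      then show "\<exists>n. real k < m n \<omega>" ..
    next
      fix k :: nat assume *: "\<forall>k::nat. \<exists>n. real k < m n \<omega>"
      obtain k' :: nat where k': "real k + \<bar>h x\<bar> \<le> real k'"
        using real_arch_simple by blast
      obtain n where n: "real k' < m n \<omega>"
        using * by blast
      then have "real k < m (Suc n) (case_nat x \<omega>)"
        using k' by (simp add: m_Suc)
      then show "\<exists>n. real k < m n (case_nat x \<omega>)" ..
    qed
    moreover have "case_nat x \<omega> \<in> space S"
      using that by (auto simp: space_PiM PiE_iff split: nat.splits)
    ultimately show ?thesis
      using that by (simp add: A_def)
  qed
  have fst_int: "integrable (M \<Otimes>\<^sub>M S) (\<lambda>p. h (fst p))"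
    using h by (intro Fubini_integrable) auto
  have snd_int: "integrable (M \<Otimes>\<^sub>M S) (\<lambda>p. m n (snd p))" for n
    using m_int by (intro Fubini_integrable) auto
  define D where "D n p = max (- m n (snd p)) (h (fst p)) * indicator A (snd p)" for n p
  have D_nonneg: "0 \<le> (\<integral>p. D n p \<partial>(M \<Otimes>\<^sub>M S))" for n
  proof -
    have int: "integrable (M \<Otimes>\<^sub>M S) (\<lambda>p. m n (snd p) * indicator A (snd p))" for n
      by (rule Bochner_Integration.integrable_bound[OF snd_int[of n]]) (auto simp: indicator_def)
    have int': "integrable (M \<Otimes>\<^sub>M S) (\<lambda>p. max 0 (h (fst p) + m n (snd p)) * indicator A (snd p))"
      by (rule Bochner_Integration.integrable_bound[OF Bochner_Integration.integrable_add[OF fst_int snd_int[of n]]])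
        (auto simp: indicator_def)
    have int_S: "integrable S (\<lambda>\<omega>. m n \<omega> * indicator A \<omega>)" for n
      by (rule Bochner_Integration.integrable_bound[OF m_int[of n]]) (auto simp: indicator_def)
    have "(\<integral>p. m n (snd p) * indicator A (snd p) \<partial>(M \<Otimes>\<^sub>M S)) = (\<integral>\<omega>. m n \<omega> * indicator A \<omega> \<partial>S)"
      using integral_fst'[OF int[of n]] by (simp add: M.prob_space)
    also have "\<dots> \<le> (\<integral>\<omega>. m (Suc n) \<omega> * indicator A \<omega> \<partial>S)"
      by (intro integral_mono int_S mult_right_mono incseq_SucD[OF m_mono]) auto
    \<comment> \<open>Stationarity: prepending an independent draw from \<open>M\<close> to a
      sequence with law \<open>S\<close> gives a sequence with law \<open>S\<close> again.\<close>
    also have "\<dots> = (\<integral>\<omega>. m (Suc n) \<omega> * indicator A \<omega> \<partial>distr (M \<Otimes>\<^sub>M S) S (\<lambda>(s, \<omega>). case_nat s \<omega>))"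
      by (simp add: PiM_iter)
    also have "\<dots> = (\<integral>p. m (Suc n) (case_nat (fst p) (snd p)) * indicator A (case_nat (fst p) (snd p)) \<partial>(M \<Otimes>\<^sub>M S))"
      by (subst integral_distr) (auto simp: case_prod_unfold)
    also have "\<dots> = (\<integral>p. max 0 (h (fst p) + m n (snd p)) * indicator A (snd p) \<partial>(M \<Otimes>\<^sub>M S))"
      by (intro Bochner_Integration.integral_cong) (auto simp: m_Suc A_shift space_pair_measure indicator_def)
    finally have "0 \<le> (\<integral>p. max 0 (h (fst p) + m n (snd p)) * indicator A (snd p) \<partial>(M \<Otimes>\<^sub>M S))
        - (\<integral>p. m n (snd p) * indicator A (snd p) \<partial>(M \<Otimes>\<^sub>M S))"
      by simp
    also have "\<dots> = (\<integral>p. D n p \<partial>(M \<Otimes>\<^sub>M S))"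
      unfolding Bochner_Integration.integral_diff[OF int' int, symmetric] D_def
      by (intro Bochner_Integration.integral_cong) (auto simp: max_def algebra_simps)
    finally show ?thesis .
  qed
  have D_lim: "(\<lambda>n. \<integral>p. D n p \<partial>(M \<Otimes>\<^sub>M S)) \<longlonglongrightarrow> (\<integral>p. h (fst p) * indicator A (snd p) \<partial>(M \<Otimes>\<^sub>M S))"
  proof (rule integral_dominated_convergence)
    show "integrable (M \<Otimes>\<^sub>M S) (\<lambda>p. \<bar>h (fst p)\<bar>)"
      using fst_int by simp
    show "AE p in M \<Otimes>\<^sub>M S. norm (D n p) \<le> \<bar>h (fst p)\<bar>" for n
    proof (rule AE_I2)
      fix p show "norm (D n p) \<le> \<bar>h (fst p)\<bar>"
        using m_nonneg[of n "snd p"] by (auto simp: D_def indicator_def max_def)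
    qed
    show "AE p in M \<Otimes>\<^sub>M S. (\<lambda>n. D n p) \<longlonglongrightarrow> h (fst p) * indicator A (snd p)"
    proof (rule AE_I2)
      fix p
      show "(\<lambda>n. D n p) \<longlonglongrightarrow> h (fst p) * indicator A (snd p)"
      proof (cases "snd p \<in> A")
        case True
        obtain k :: nat where k: "\<bar>h (fst p)\<bar> \<le> real k"
          using real_arch_simple by blast
        obtain N where N: "real k < m N (snd p)"
          using True by (auto simp: A_def)
        \<comment> \<open>Once the running maximum exceeds the absolute value of
          \<open>h (fst p)\<close>, the maximum in \<open>D\<close> is \<open>h (fst p)\<close>
          itself, so the sequence is eventually constant.\<close>
        have "D n p = h (fst p) * indicator A (snd p)" if "n \<ge> N" for n
          using k N incseqD[OF m_mono that, of "snd p"] by (simp add: D_def)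
        then show ?thesis
          by (intro tendsto_eventually) (auto simp: eventually_sequentially)
      qed (simp add: D_def)
    qed
  qed (unfold D_def, measurable)
  have "0 \<le> (\<integral>p. h (fst p) * indicator A (snd p) \<partial>(M \<Otimes>\<^sub>M S))"
    using D_nonneg by (intro LIMSEQ_le_const[OF D_lim]) blast
  also have "\<dots> = (\<integral>x. h x * measure S A \<partial>M)"
  proof -
    have "integrable (M \<Otimes>\<^sub>M S) (\<lambda>p. h (fst p) * indicator A (snd p))"
      by (rule Bochner_Integration.integrable_bound[OF fst_int]) (auto simp: indicator_def)
    from integral_fst'[OF this] show ?thesis
      by simp
  qed
  also have "\<dots> = (\<integral>x. h x \<partial>M) * measure S A"
    by simp
  finally have "measure S A = 0"
    using neg by (simp add: zero_le_mult_iff measure_le_0_iff)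
  then have "AE \<omega> in S. \<omega> \<notin> A"
    by (simp add: P.prob_eq_0)
  then show ?thesis
  proof (rule AE_mp, intro AE_I2 impI)
    fix \<omega> assume "\<omega> \<in> space S" "\<omega> \<notin> A"
    then obtain k :: nat where "\<And>n. m n \<omega> \<le> real k"
      by (auto simp: A_def not_less)
    then show "bdd_above (range (\<lambda>n. \<Sum>i<n. h (\<omega> i)))"
      unfolding m_def by (auto intro!: bdd_aboveI2 order_trans[OF sum_le_running_max])
  qed
qed

text \<open>For \<open>r\<close> strictly between the mean and \<open>c\<close>, the function
  \<open>h - r\<close> has negative mean, so its partial sums stay below some random
  \<open>B\<close>. The linear gap \<open>(c - r) * real n\<close> eventually exceeds
  \<open>B\<close>.\<close>

lemma AE_eventually_sum_less:
  fixes h :: "'a \<Rightarrow> real"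
  assumes h: "integrable M h" and less: "(\<integral>x. h x \<partial>M) < c"
  shows "AE \<omega> in S. \<forall>\<^sub>F n in sequentially. (\<Sum>i<n. h (\<omega> i)) < c * real n"
proof -
  obtain r where r: "(\<integral>x. h x \<partial>M) < r" "r < c"
    using dense[OF less] by blast
  have "AE \<omega> in S. bdd_above (range (\<lambda>n. \<Sum>i<n. h (\<omega> i) - r))"
    by (rule AE_bdd_above_partial_sums) (use h r M.prob_space in auto)
  then show ?thesis
  proof (rule AE_mp, intro AE_I2 impI)
    fix \<omega> :: "nat \<Rightarrow> 'a"
    assume "bdd_above (range (\<lambda>n. \<Sum>i<n. h (\<omega> i) - r))"
    then obtain B where B: "(\<Sum>i<n. h (\<omega> i) - r) \<le> B" for n
      by (auto simp: bdd_above_def)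
    have "\<forall>\<^sub>F n in sequentially. B / (c - r) < real n"
      using filterlim_real_sequentially by (auto simp: filterlim_at_top_dense)
    then show "\<forall>\<^sub>F n in sequentially. (\<Sum>i<n. h (\<omega> i)) < c * real n"
    proof eventually_elim
      case (elim n)
      then have "B < (c - r) * real n"
        using r by (simp add: pos_divide_less_eq mult.commute)
      with B[of n] show ?case
        by (simp add: sum_subtractf algebra_simps)
    qed
  qed
qed

end

text \<open>The joint law of an i.i.d. sequence is the product measure, so the almost sure statement
  transfers from the canonical sequence space.\<close>

lemma (in prob_space) iid_AE_eventually_sum_less:
  fixes \<xi> :: "nat \<Rightarrow> 'a \<Rightarrow> 'b :: second_countable_topology"
  assumes indep: "indep_vars (\<lambda>_. borel) \<xi> {1..}"
    and ident: "\<And>t. t \<ge> 1 \<Longrightarrow> distr M borel (\<xi> t) = N"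
    and h: "integrable N (h :: 'b \<Rightarrow> real)" and less: "(\<integral>x. h x \<partial>N) < c"
  shows "AE \<omega> in M. \<forall>\<^sub>F n in sequentially. (\<Sum>t = 1..n. h (\<xi> t \<omega>)) < c * real n"
proof -
  have rv: "\<xi> t \<in> borel_measurable M" if "t \<ge> 1" for t
    using indep that by (auto simp: indep_vars_def)
  have joint: "distr M (Pi\<^sub>M {1..} (\<lambda>_. borel)) (\<lambda>\<omega>. \<lambda>t\<in>{1..}. \<xi> t \<omega>)
      = Pi\<^sub>M {1..} (\<lambda>t. distr M borel (\<xi> t))"
    using indep rv indep_vars_iff_distr_eq_PiM'[of "{1..}" \<xi> "\<lambda>_. borel"] by simp
  have N: "prob_space N" and sets_N: "sets N = sets borel"
    using ident[of 1] rv[of 1] by (auto intro: prob_space_distr)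
  have space_N: "space N = UNIV"
    using sets_eq_imp_space_eq[OF sets_N] by simp
  interpret N: prob_space N by fact
  interpret sequence_space N
    by (unfold_locales) 
  \<comment> \<open>The data are indexed from 1 and the sequence space from 0, hence the reindexing
    along \<open>Suc\<close>.\<close>
  have "S = distr (Pi\<^sub>M {1..} (\<lambda>_. N)) S (\<lambda>\<omega>. \<lambda>n\<in>UNIV. \<omega> (Suc n))"
    using distr_PiM_reindex[of "{1..}" "\<lambda>_. N" Suc UNIV] N by simp
  also have "Pi\<^sub>M {1..} (\<lambda>_. N) = Pi\<^sub>M {1..} (\<lambda>t. distr M borel (\<xi> t))"
    by (rule PiM_cong) (simp_all add: ident)
  also have "\<dots> = distr M (Pi\<^sub>M {1..} (\<lambda>_. borel)) (\<lambda>\<omega>. \<lambda>t\<in>{1..}. \<xi> t \<omega>)"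
    by (rule joint[symmetric])
  also have "distr \<dots> S (\<lambda>\<omega>. \<lambda>n\<in>UNIV. \<omega> (Suc n)) = distr M S (\<lambda>\<omega> i. \<xi> (Suc i) \<omega>)"
    using rv by (subst distr_distr) (auto simp: comp_def restrict_UNIV sets_N space_N cong: measurable_cong_sets
        intro!: measurable_PiM_single' measurable_restrict)
  finally have eq: "distr M S (\<lambda>\<omega> i. \<xi> (Suc i) \<omega>) = S" ..
  have "(\<lambda>\<omega> i. \<xi> (Suc i) \<omega>) \<in> measurable M S"
    by (rule measurable_PiM_single') (use rv sets_N in \<open>auto simp: space_N cong: measurable_cong_sets\<close>)
  moreover have "AE \<omega> in distr M S (\<lambda>\<omega> i. \<xi> (Suc i) \<omega>).
      \<forall>\<^sub>F n in sequentially. (\<Sum>i<n. h (\<omega> i)) < c * real n"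
    unfolding eq using h less by (rule AE_eventually_sum_less)
  ultimately have "AE \<omega> in M. \<forall>\<^sub>F n in sequentially. (\<Sum>i<n. h (\<xi> (Suc i) \<omega>)) < c * real n"
    by (rule AE_distrD)
  then show ?thesis
    by (simp add: sum.atLeast1_atMost_eq)
qed

section \<open>Consistency of minimisers of empirical means\<close>

text \<open>Continuity keeps \<open>f\<close> within \<open>e / 2\<close> of
  \<open>f \<theta>\<close> on small balls, and then so is the infimum over any nonempty part of
  them. This supplies the pointwise limit for dominated convergence in Wald's argument.\<close>

lemma cINF_tendsto_at_point:
  fixes f :: "'p::metric_space \<Rightarrow> real"
  assumes cont: "continuous_on \<Theta> f" and \<theta>: "\<theta> \<in> \<Theta>"
    and bound: "\<And>\<theta>. \<theta> \<in> \<Theta> \<Longrightarrow> \<bar>f \<theta>\<bar> \<le> C"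
    and D: "\<And>k. D k \<subseteq> \<Theta> \<inter> ball \<theta> (1 / real (Suc k))" "\<And>k. D k \<noteq> {}"
  shows "(\<lambda>k. INF t\<in>D k. f t) \<longlonglongrightarrow> f \<theta>"
proof (rule LIMSEQ_I)
  fix e :: real assume e: "0 < e"
  then obtain d where d: "0 < d" "\<And>t. t \<in> \<Theta> \<Longrightarrow> dist t \<theta> < d \<Longrightarrow> \<bar>f t - f \<theta>\<bar> < e / 2"
    using cont \<theta> half_gt_zero[OF e] unfolding continuous_on_iff dist_real_def by metis
  obtain K where K: "1 / real (Suc K) < d"
    using nat_approx_posE[OF d(1)] by blast
  have "norm ((INF t\<in>D k. f t) - f \<theta>) < e" if "k \<ge> K" for k
  proof -
    have "1 / real (Suc k) \<le> 1 / real (Suc K)"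
      using that by (intro divide_left_mono) auto
    then have close: "\<bar>f t - f \<theta>\<bar> < e / 2" if "t \<in> D k" for t
      using D(1)[of k] that K by (intro d(2)) (auto simp: dist_commute)
    then have lower: "f \<theta> - e / 2 \<le> f t" if "t \<in> D k" for t
      using that by (smt (verit))
    then have bdd: "bdd_below (f ` D k)"
      by (rule bdd_belowI2)
    obtain t where t: "t \<in> D k"
      using D(2) by blast
    have "f \<theta> - e / 2 \<le> (INF t\<in>D k. f t)"
      using D(2) lower by (rule cINF_greatest)
    moreover have "(INF t\<in>D k. f t) \<le> f t"
      using bdd t by (rule cINF_lower)
    ultimately show ?thesis
      using close[OF t] e unfolding real_norm_def by linarith
  qed
  then show "\<exists>K. \<forall>k\<ge>K. norm ((INF t\<in>D k. f t) - f \<theta>) < e"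
    by blast
qed

text \<open>By continuity, an infimum over a dense subset is a lower bound on the whole set. A
  countable, hence measurable, infimum can thus control all parameters in a ball.\<close>

lemma cINF_le_closure:
  fixes f :: "'p::metric_space \<Rightarrow> real"
  assumes cont: "continuous_on A f" and t: "t \<in> A" and D: "D \<subseteq> A" "A \<subseteq> closure D"
    and bdd: "bdd_below (f ` D)"
  shows "(INF s\<in>D. f s) \<le> f t"
proof -
  have "t \<in> closure D"
    using t D(2) by blast
  then obtain d where d: "\<And>n. d n \<in> D" "d \<longlonglongrightarrow> t"
    unfolding closure_sequential by blast
  then have "(\<lambda>n. f (d n)) \<longlonglongrightarrow> f t"
    using D(1) by (intro continuous_on_tendsto_compose[OF cont d(2) t] always_eventually) auto
  then show ?thesis
    using d(1) bdd by (intro LIMSEQ_le_const) (auto intro: cINF_lower)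
qed

text \<open>Wald's argument: near a non-minimal \<open>t\<close> the empirical means are bounded below by those of
  an infimum of \<open>f\<close> over a small ball, whose expectation exceeds the minimal one.\<close>

lemma (in prob_space) argmin_consistency:
  fixes \<xi> :: "nat \<Rightarrow> 'a \<Rightarrow> 'b :: {second_countable_topology,metric_space}"
    and \<Theta> :: "'p :: {metric_space,second_countable_topology} set"
    and f :: "'p \<Rightarrow> 'b \<Rightarrow> real"
  assumes indep: "indep_vars (\<lambda>_. borel) \<xi> {1..}"
    and ident: "\<And>t. t \<ge> 1 \<Longrightarrow> distr M borel (\<xi> t) = N"
    and \<Theta>: "compact \<Theta>" "\<Theta> \<noteq> {}"
    and cont: "continuous_on (\<Theta> \<times> UNIV) (\<lambda>(t, x). f t x)"
    and g: "integrable N g" and bound: "\<And>t x. t \<in> \<Theta> \<Longrightarrow> \<bar>f t x\<bar> \<le> g x"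
    and \<theta>_mem: "\<And>n \<omega>. n \<ge> 1 \<Longrightarrow> \<omega> \<in> space M \<Longrightarrow> \<theta> n \<omega> \<in> \<Theta>"
    and \<theta>_min: "\<And>n \<omega> t. n \<ge> 1 \<Longrightarrow> \<omega> \<in> space M \<Longrightarrow> t \<in> \<Theta> \<Longrightarrow>
      (\<Sum>i = 1..n. f (\<theta> n \<omega>) (\<xi> i \<omega>)) \<le> (\<Sum>i = 1..n. f t (\<xi> i \<omega>))"
    and S: "S = {t \<in> \<Theta>. \<forall>t'\<in>\<Theta>. (\<integral>x. f t x \<partial>N) \<le> (\<integral>x. f t' x \<partial>N)}"
  shows "S \<noteq> {} \<and> (AE \<omega> in M. (\<lambda>n. infdist (\<theta> n \<omega>) S) \<longlonglongrightarrow> 0)"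
proof -
  have sets_N [measurable_cong]: "sets N = sets borel"
    using ident[of 1] by auto
  have space_N: "space N = UNIV"
    using sets_eq_imp_space_eq[OF sets_N] by simp
  have cont_t: "continuous_on \<Theta> (\<lambda>t. f t x)" for x
    by (rule continuous_on_compose2[OF cont, of \<Theta> "\<lambda>t. (t, x)", simplified]) (auto intro!: continuous_intros)
  have cont_x: "continuous_on UNIV (f t)" if "t \<in> \<Theta>" for t
    by (rule continuous_on_compose2[OF cont, of UNIV "\<lambda>x. (t, x)", simplified]) (auto intro!: continuous_intros that)
  have f_meas: "f t \<in> borel_measurable N" if "t \<in> \<Theta>" for t
    using borel_measurable_continuous_onI[OF cont_x[OF that]] by simp
  have f_int: "integrable N (f t)" if "t \<in> \<Theta>" for t
    by (rule Bochner_Integration.integrable_bound[OF g f_meas[OF that]])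
      (use bound[OF that] in \<open>auto intro!: AE_I2 order_trans[OF _ abs_ge_self]\<close>)
  define \<phi> where "\<phi> t = (\<integral>x. f t x \<partial>N)" for t
  \<comment> \<open>Dominated convergence with envelope \<open>g\<close> gives continuity;
    compactness then provides a minimiser \<open>t\<^sub>0\<close>.\<close>
  have "continuous_on \<Theta> \<phi>"
    unfolding continuous_on_sequentially comp_def
  proof (intro allI ballI impI, elim conjE)
    fix u t assume t: "t \<in> \<Theta>" and u: "\<forall>n. u n \<in> \<Theta>" "u \<longlonglongrightarrow> t"
    show "(\<lambda>n. \<phi> (u n)) \<longlonglongrightarrow> \<phi> t"
      unfolding \<phi>_def
    proof (rule integral_dominated_convergence[OF _ _ g])
      show "AE x in N. (\<lambda>n. f (u n) x) \<longlonglongrightarrow> f t x"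
        using continuous_on_tendsto_compose[OF cont_t u(2) t] u(1) by auto
    qed (use f_meas t u bound in auto)
  qed
  then obtain t\<^sub>0 where t\<^sub>0: "t\<^sub>0 \<in> \<Theta>" "\<And>t. t \<in> \<Theta> \<Longrightarrow> \<phi> t\<^sub>0 \<le> \<phi> t"
    using continuous_attains_inf[OF \<Theta>] by blast
  then have "t\<^sub>0 \<in> S"
    by (auto simp: S \<phi>_def)
  have S_eq: "t \<in> S \<longleftrightarrow> \<phi> t \<le> \<phi> t\<^sub>0" if "t \<in> \<Theta>" for t
    using that t\<^sub>0 by (auto simp: S simp flip: \<phi>_def intro: order_trans)
  have away: "\<exists>d>0. AE \<omega> in M. \<forall>\<^sub>F n in sequentially. \<theta> n \<omega> \<notin> ball t d"
    if t: "t \<in> \<Theta>" "t \<notin> S" for t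
  proof -
    have less: "\<phi> t\<^sub>0 < \<phi> t"
      using S_eq t by simp
    then obtain c where c: "\<phi> t\<^sub>0 < c" "c < \<phi> t"
      using dense by blast
    \<comment> \<open>Countable dense subsets of the shrinking balls make the infimum
      \<open>m k\<close> measurable.\<close>
    have "\<exists>D. countable D \<and> D \<subseteq> \<Theta> \<inter> ball t (1 / real (Suc k)) \<and> \<Theta> \<inter> ball t (1 / real (Suc k)) \<subseteq> closure D"
      for k by (meson separable)
    then obtain D where D: "\<And>k. countable (D k)" "\<And>k. D k \<subseteq> \<Theta> \<inter> ball t (1 / real (Suc k))"
      "\<And>k. \<Theta> \<inter> ball t (1 / real (Suc k)) \<subseteq> closure (D k)"
      by metis
    have D_ne: "D k \<noteq> {}" for k
      using D(3)[of k] t(1) by auto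
    have D_\<Theta>: "D k \<subseteq> \<Theta>" for k
      using D(2) by blast
    define m where "m k x = (INF s\<in>D k. f s x)" for k x
    have lower: "- g x \<le> f s x" if "s \<in> D k" for k s x
      using bound[of s x] D_\<Theta> that by fastforce
    then have bdd: "bdd_below ((\<lambda>s. f s x) ` D k)" for k x
      by (rule bdd_belowI2)
    have m_meas: "m k \<in> borel_measurable N" for k
      unfolding m_def using D_\<Theta> f_meas by (intro borel_measurable_cINF D(1) bdd) auto
    have m_bound: "\<bar>m k x\<bar> \<le> g x" for k x
    proof -
      obtain s where s: "s \<in> D k"
        using D_ne by blast
      have "m k x \<le> f s x"
        unfolding m_def by (rule cINF_lower[OF bdd s])
      moreover have "- g x \<le> m k x"
        unfolding m_def using D_ne lower by (rule cINF_greatest)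
      ultimately show ?thesis
        using bound[of s x] s D_\<Theta> by fastforce
    qed
    have m_int: "integrable N (m k)" for k
      by (rule Bochner_Integration.integrable_bound[OF g m_meas])
        (use m_bound in \<open>auto intro!: AE_I2 order_trans[OF _ abs_ge_self]\<close>)
    have "(\<lambda>k. \<integral>x. m k x \<partial>N) \<longlonglongrightarrow> \<phi> t"
      unfolding \<phi>_def
    proof (rule integral_dominated_convergence[OF _ _ g])
      show "AE x in N. (\<lambda>k. m k x) \<longlonglongrightarrow> f t x"
        unfolding m_def using cINF_tendsto_at_point[OF cont_t t(1) bound D(2) D_ne] by auto
    qed (use f_meas t m_meas m_bound in auto)
    then obtain k where k: "c < (\<integral>x. m k x \<partial>N)"
      using order_tendstoD(1)[OF _ c(2)] eventually_sequentially by (metis order_refl)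
    \<comment> \<open>The one-sided law bounds sums from above; applied to \<open>- m k\<close> with
      threshold \<open>- c\<close> it bounds the sums of \<open>m k\<close> from below.\<close>
    have "AE \<omega> in M. \<forall>\<^sub>F n in sequentially. (\<Sum>i = 1..n. - m k (\<xi> i \<omega>)) < - c * real n"
      by (rule iid_AE_eventually_sum_less[OF indep ident]) (use m_int k in auto)
    moreover have "AE \<omega> in M. \<forall>\<^sub>F n in sequentially. (\<Sum>i = 1..n. f t\<^sub>0 (\<xi> i \<omega>)) < c * real n"
      by (rule iid_AE_eventually_sum_less[OF indep ident]) (use f_int t\<^sub>0 c in \<open>auto simp: \<phi>_def\<close>)
    ultimately have "AE \<omega> in M. \<forall>\<^sub>F n in sequentially. \<theta> n \<omega> \<notin> ball t (1 / real (Suc k))"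
      using AE_space
    proof eventually_elim
      case (elim \<omega>)
      \<comment> \<open>Nothing is assumed about the estimate for sample size 0.\<close>
      have "\<forall>\<^sub>F n in sequentially. (1::nat) \<le> n"
        by (rule eventually_ge_at_top)
      with elim(1,2) show ?case
      proof eventually_elim
        case (elim n)
        show ?case
        proof
          assume near: "\<theta> n \<omega> \<in> ball t (1 / real (Suc k))"
          have "c * real n < (\<Sum>i = 1..n. m k (\<xi> i \<omega>))"
            using elim(1) by (simp add: sum_negf)
          also have "\<dots> \<le> (\<Sum>i = 1..n. f (\<theta> n \<omega>) (\<xi> i \<omega>))"
            unfolding m_def using near \<theta>_mem[OF elim(3) \<open>\<omega> \<in> space M\<close>] D(2,3)
            by (intro sum_mono cINF_le_closure[where A = "\<Theta> \<inter> ball t (1 / real (Suc k))"] bdd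
                continuous_on_subset[OF cont_t]) auto
          also have "\<dots> \<le> (\<Sum>i = 1..n. f t\<^sub>0 (\<xi> i \<omega>))"
            by (rule \<theta>_min[OF elim(3) \<open>\<omega> \<in> space M\<close> t\<^sub>0(1)])
          finally show False
            using elim(2) by simp
        qed
      qed
    qed
    then show ?thesis
      by (intro exI[of _ "1 / real (Suc k)"]) simp
  qed
  have "AE \<omega> in M. \<forall>\<^sub>F n in sequentially. infdist (\<theta> n \<omega>) S < e" if e: "0 < e" for e :: real
  proof -
    \<comment> \<open>The parameters at distance at least \<open>e\<close> from \<open>S\<close>
      form a compact set, so finitely many of the avoided balls cover it and the finitely many null
      sets can be merged.\<close>
    define K where "K = \<Theta> \<inter> {t. e \<le> infdist t S}"
    have "compact K"
      unfolding K_def by (intro compact_Int_closed \<Theta> closed_Collect_le continuous_intros)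
    have "t \<in> \<Theta> \<and> t \<notin> S" if "t \<in> K" for t
      using that e by (auto simp: K_def)
    then have "\<forall>t\<in>K. \<exists>d>0. AE \<omega> in M. \<forall>\<^sub>F n in sequentially. \<theta> n \<omega> \<notin> ball t d"
      using away by blast
    from bchoice[OF this] obtain d where d: "\<forall>t\<in>K. 0 < d t \<and>
        (AE \<omega> in M. \<forall>\<^sub>F n in sequentially. \<theta> n \<omega> \<notin> ball t (d t))"
      by blast
    have "K \<subseteq> (\<Union>t\<in>K. ball t (d t))"
      using d by force
    then obtain F where F: "F \<subseteq> K" "finite F" "K \<subseteq> (\<Union>t\<in>F. ball t (d t))"
      using compactE_image[OF \<open>compact K\<close>, of K "\<lambda>t. ball t (d t)"] by auto
    have "AE \<omega> in M. \<forall>t\<in>F. \<forall>\<^sub>F n in sequentially. \<theta> n \<omega> \<notin> ball t (d t)"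
      using F d by (intro AE_finite_allI) auto
    with AE_space show ?thesis
    proof eventually_elim
      case (elim \<omega>)
      then have "\<forall>\<^sub>F n in sequentially. \<forall>t\<in>F. \<theta> n \<omega> \<notin> ball t (d t)"
        using F(2) by (simp add: eventually_ball_finite)
      with eventually_ge_at_top[of 1] show ?case
      proof eventually_elim
        case (elim n)
        then have "\<theta> n \<omega> \<notin> K" "\<theta> n \<omega> \<in> \<Theta>"
          using F(3) \<theta>_mem \<open>\<omega> \<in> space M\<close> by blast+
        then show ?case
          by (auto simp: K_def)
      qed
    qed
  qed
  \<comment> \<open>Tolerances of the form \<open>1 / real (Suc k)\<close> leave only countably many
    exceptional null sets.\<close>
  then have "AE \<omega> in M. \<forall>k. \<forall>\<^sub>F n in sequentially. infdist (\<theta> n \<omega>) S < 1 / real (Suc k)"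
    by (simp add: AE_all_countable)
  then have "AE \<omega> in M. (\<lambda>n. infdist (\<theta> n \<omega>) S) \<longlonglongrightarrow> 0"
  proof eventually_elim
    case (elim \<omega>)
    show ?case
    proof (rule order_tendstoI)
      fix e :: real assume "0 < e"
      then obtain k where k: "1 / real (Suc k) < e"
        using nat_approx_posE by blast
      have "\<forall>\<^sub>F n in sequentially. infdist (\<theta> n \<omega>) S < 1 / real (Suc k)"
        using elim by blast
      then show "\<forall>\<^sub>F n in sequentially. infdist (\<theta> n \<omega>) S < e"
        by eventually_elim (use k in simp)
    next
      fix a :: real assume "a < 0"
      then have "a < infdist (\<theta> n \<omega>) S" for n
        using infdist_nonneg by (rule less_le_trans)
      then show "\<forall>\<^sub>F n in sequentially. a < infdist (\<theta> n \<omega>) S"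
        by simp
    qed
  qed
  with \<open>t\<^sub>0 \<in> S\<close> show ?thesis
    by blast
qed

section \<open>Consistency of the bilevel estimator\<close>

text \<open>Nonemptiness of \<open>S_opt\<close> belongs to the conclusion because
  \<open>infdist\<close> to the empty set is 0 by convention, which would make the convergence
  trivial.\<close>

theorem theorem1:
  fixes ca cp :: "real^'d"
    and qa :: "real^'ua" and Wa :: "real^'ua^'ra" and ba :: "real^'ra"
    and Ha :: "real^'d^'ra" and Fa :: "real^'n^'ra"
    and qp :: "real^'up" and Wp :: "real^'up^'rp" and bp :: "real^'rp"
    and Hp :: "real^'d^'rp" and Fp :: "real^'n^'rp"
    and Ga Gp :: "real^'d \<Rightarrow> real^'n \<Rightarrow> ereal"
    and Z :: "(real^'d) set"
    and \<Theta> :: "'p::euclidean_space set"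
    and \<Psi> :: "'p \<Rightarrow> real^'m \<Rightarrow> real^'n"
    and M :: "'w measure"
    and X :: "nat \<Rightarrow> 'w \<Rightarrow> real^'m" and Y :: "nat \<Rightarrow> 'w \<Rightarrow> real^'n"
    and X0 :: "'w \<Rightarrow> real^'m" and Y0 :: "'w \<Rightarrow> real^'n"
    and \<theta> :: "nat \<Rightarrow> 'w \<Rightarrow> 'p"
    and S_opt :: "'p set"
  assumes Ga: "Ga = two_stage_cost ca qa Wa ba Ha Fa"
    and Gp: "Gp = two_stage_cost cp qp Wp bp Hp Fp"
    and A1: "\<And>\<theta> x. \<theta> \<in> \<Theta> \<Longrightarrow>
      (\<exists>z\<in>Z. Gp z (\<Psi> \<theta> x) < \<infinity>) \<and> (\<exists>!z. z \<in> argmin_set (\<lambda>z. Gp z (\<Psi> \<theta> x)) Z)"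
    and A2: "Z \<noteq> {}" "bounded Z" "polyhedron Z"
    and A3: "{\<pi>. transpose Wa *v \<pi> = qa \<and> \<pi> \<ge> 0} \<noteq> {}"
      "bounded {\<pi>. transpose Wa *v \<pi> = qa \<and> \<pi> \<ge> 0}"
    and cont: "continuous_on (\<Theta> \<times> UNIV) (\<lambda>(\<theta>, x). \<Psi> \<theta> x)"
    and prob: "prob_space M"
    and indep: "prob_space.indep_vars M (\<lambda>_. borel) (\<lambda>t \<omega>. (X t \<omega>, Y t \<omega>)) {1..}"
    and generic: "(\<lambda>\<omega>. (X0 \<omega>, Y0 \<omega>)) \<in> borel_measurable M"
    and ident: "\<And>t. t \<ge> 1 \<Longrightarrow>
      distr M borel (\<lambda>\<omega>. (X t \<omega>, Y t \<omega>)) = distr M borel (\<lambda>\<omega>. (X0 \<omega>, Y0 \<omega>))"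
    and integ: "integrable M Y0"
    and Theta: "compact \<Theta>" "\<Theta> \<noteq> {}"
    and theta: "\<And>T \<omega>. T \<ge> 1 \<Longrightarrow> \<omega> \<in> space M \<Longrightarrow>
      \<theta> T \<omega> \<in> bilevel_solutions Ga Gp Z \<Theta> \<Psi> (\<lambda>t. X t \<omega>) (\<lambda>t. Y t \<omega>) T"
    and S_opt: "S_opt = argmin_set
      (\<lambda>\<theta>. ereal_expectation M (\<lambda>\<omega>. Ga (optimal_decision Gp Z (\<Psi> \<theta> (X0 \<omega>))) (Y0 \<omega>))) \<Theta>"
  shows "S_opt \<noteq> {} \<and> (AE \<omega> in M. (\<lambda>T. infdist (\<theta> T \<omega>) S_opt) \<longlonglongrightarrow> 0)"
proof -
  interpret prob_space M by (rule prob)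
  obtain g C where g: "\<And>z y. Ga z y = ereal (g z y)" "continuous_on UNIV (\<lambda>(z, y). g z y)"
    and C: "0 \<le> C" "\<And>z y. \<bar>g z y\<bar> \<le> C * (1 + norm z + norm y)"
    using two_stage_cost_continuous[OF A3, of ca ba Ha Fa] unfolding Ga by metis
  obtain B where B: "\<And>z. z \<in> Z \<Longrightarrow> norm z \<le> B"
    using A2(2) by (auto simp: bounded_iff)
  define \<zeta> where "\<zeta> = optimal_decision Gp Z"
  \<comment> \<open>The set of possible forecasts: only there does (A1) guarantee unique decisions,
    so continuity of \<open>\<zeta>\<close> is claimed on this set.\<close>
  define D where "D = (\<lambda>(t, x). \<Psi> t x) ` (\<Theta> \<times> UNIV)"
  have unique: "\<exists>!z. z \<in> argmin_set (\<lambda>z. Gp z y) Z" if "y \<in> D" for y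
  proof -
    obtain t x where "t \<in> \<Theta>" "y = \<Psi> t x"
      using \<open>y \<in> D\<close> by (auto simp: D_def)
    then show ?thesis
      using A1 by blast
  qed
  have argmin: "argmin_set (\<lambda>z. Gp z y) Z = {\<zeta> y}" if "y \<in> D" for y
    using argmin_set_eq_optimal_decision[where G = Gp, OF unique[OF that]] by (simp add: \<zeta>_def)
  have \<zeta>_Z: "\<zeta> y \<in> Z" if "y \<in> D" for y
    using argmin[OF that] by (auto simp: argmin_set_def is_arg_min_def)
  have \<zeta>_cont: "continuous_on D \<zeta>"
    unfolding \<zeta>_def Gp
    by (rule optimal_decision_continuous_on) (use A2 unique in \<open>simp_all add: Gp\<close>)
  have \<Psi>_D: "\<Psi> t x \<in> D" if "t \<in> \<Theta>" for t x
    using that by (auto simp: D_def)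
  define \<xi> where "\<xi> t \<omega> = (X t \<omega>, Y t \<omega>)" for t \<omega>
  define \<xi>\<^sub>0 where "\<xi>\<^sub>0 \<omega> = (X0 \<omega>, Y0 \<omega>)" for \<omega>
  define N where "N = distr M borel \<xi>\<^sub>0"
  have [measurable]: "\<xi>\<^sub>0 \<in> borel_measurable M"
    using generic by (simp add: \<xi>\<^sub>0_def [abs_def])
  define f where "f t p = g (\<zeta> (\<Psi> t (fst p))) (snd p)" for t p
  \<comment> \<open>The envelope: decisions lie in \<open>Z\<close>, so \<open>B\<close> replaces
    their norm in the growth bound, and integrability of \<open>Y0\<close> carries over.\<close>
  define h :: "(real^'m) \<times> (real^'n) \<Rightarrow> real" where "h p = C * (1 + B + norm (snd p))" for p
  have f_cont: "continuous_on (\<Theta> \<times> UNIV) (\<lambda>(t, p). f t p)"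
  proof -
    have "continuous_on (\<Theta> \<times> UNIV) (\<lambda>r. \<Psi> (fst r) (fst (snd r)))"
      by (rule continuous_on_compose2[OF cont, of _ "\<lambda>r. (fst r, fst (snd r))", simplified])
        (auto intro!: continuous_intros)
    then have "continuous_on (\<Theta> \<times> UNIV) (\<lambda>r. \<zeta> (\<Psi> (fst r) (fst (snd r))))"
      by (rule continuous_on_compose2[OF \<zeta>_cont]) (auto simp: \<Psi>_D)
    then have "continuous_on (\<Theta> \<times> UNIV) (\<lambda>r. (\<zeta> (\<Psi> (fst r) (fst (snd r))), snd (snd r)))"
      by (intro continuous_intros)
    from continuous_on_compose2[OF g(2) this] show ?thesis
      by (simp add: f_def case_prod_unfold)
  qed
  have f_bound: "\<bar>f t p\<bar> \<le> h p" if "t \<in> \<Theta>" for t p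
  proof -
    have "\<bar>f t p\<bar> \<le> C * (1 + norm (\<zeta> (\<Psi> t (fst p))) + norm (snd p))"
      unfolding f_def by (rule C)
    also have "\<dots> \<le> h p"
      unfolding h_def using B[OF \<zeta>_Z[OF \<Psi>_D[OF that]]] C(1) by (intro mult_left_mono) auto
    finally show ?thesis .
  qed
  have [measurable]: "h \<in> borel_measurable borel"
    unfolding h_def by (intro borel_measurable_continuous_onI continuous_intros)
  have "integrable M (\<lambda>\<omega>. h (\<xi>\<^sub>0 \<omega>))"
    unfolding h_def \<xi>\<^sub>0_def using integ by simp
  then have h_int: "integrable N h"
    unfolding N_def by (subst integrable_distr_eq) auto
  have f_meas: "f t \<in> borel_measurable borel" if "t \<in> \<Theta>" for t
    by (intro borel_measurable_continuous_onI
        continuous_on_compose2[OF f_cont, of UNIV "\<lambda>p. (t, p)", simplified])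
      (use that in \<open>auto intro!: continuous_intros\<close>)
  have f_int: "integrable M (\<lambda>\<omega>. f t (\<xi>\<^sub>0 \<omega>))" if "t \<in> \<Theta>" for t
  proof (rule Bochner_Integration.integrable_bound)
    show "integrable M (\<lambda>\<omega>. h (\<xi>\<^sub>0 \<omega>))"
      by fact
    show "(\<lambda>\<omega>. f t (\<xi>\<^sub>0 \<omega>)) \<in> borel_measurable M"
      using f_meas[OF that] by simp
    show "AE \<omega> in M. norm (f t (\<xi>\<^sub>0 \<omega>)) \<le> norm (h (\<xi>\<^sub>0 \<omega>))"
      using f_bound[OF that] unfolding real_norm_def by (intro AE_I2 order_trans[OF _ abs_ge_self])
  qed
  have expectation: "ereal_expectation M (\<lambda>\<omega>. Ga (optimal_decision Gp Z (\<Psi> t (X0 \<omega>))) (Y0 \<omega>))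
      = ereal (\<integral>p. f t p \<partial>N)" if "t \<in> \<Theta>" for t
    using ereal_expectation_ereal[OF f_int[OF that]] f_meas[OF that]
    unfolding N_def by (subst integral_distr) (simp_all add: g f_def \<xi>\<^sub>0_def flip: \<zeta>_def)
  have solution: "\<theta> T \<omega> \<in> \<Theta> \<and> (\<forall>t\<in>\<Theta>. (\<Sum>i = 1..T. f (\<theta> T \<omega>) (\<xi> i \<omega>)) \<le> (\<Sum>i = 1..T. f t (\<xi> i \<omega>)))"
    if T: "T \<ge> 1" and \<omega>: "\<omega> \<in> space M" for T \<omega>
  proof -
    let ?feas = "bilevel_feasible Gp Z \<Theta> \<Psi> (\<lambda>t. X t \<omega>) T"
    let ?obj = "bilevel_objective Ga (\<lambda>t. Y t \<omega>) T"
    \<comment> \<open>Feasibility forces every planned decision to be the unique minimiser, so the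
      objective depends on the parameter alone and the bilevel problem collapses to minimising an
      empirical mean.\<close>
    have obj: "?obj (t, yhat, z) = ereal (1 / real T * (\<Sum>i = 1..T. f t (\<xi> i \<omega>)))"
      if "(t, yhat, z) \<in> ?feas" for t yhat z
    proof -
      have "t \<in> \<Theta>" and "\<forall>i\<in>{1..T}. yhat i = \<Psi> t (X i \<omega>) \<and> z i \<in> argmin_set (\<lambda>z'. Gp z' (yhat i)) Z"
        using that unfolding bilevel_feasible_def mem_Collect_eq prod.case by blast+
      then have z: "z i \<in> argmin_set (\<lambda>z'. Gp z' (\<Psi> t (X i \<omega>))) Z" if "i \<in> {1..T}" for i
        using that by fastforce
      have "z i = \<zeta> (\<Psi> t (X i \<omega>))" if "i \<in> {1..T}" for i
        using z[OF that] argmin[OF \<Psi>_D[OF \<open>t \<in> \<Theta>\<close>]] by simp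
      then have "(\<Sum>i = 1..T. Ga (z i) (Y i \<omega>)) = (\<Sum>i = 1..T. ereal (f t (\<xi> i \<omega>)))"
        by (intro sum.cong) (simp_all add: g f_def \<xi>_def)
      then show ?thesis
        by (simp add: bilevel_objective_def)
    qed
    obtain yhat z where opt: "(\<theta> T \<omega>, yhat, z) \<in> argmin_set ?obj ?feas"
      using theta[OF T \<omega>] by (force simp: bilevel_solutions_def)
    then have feas: "(\<theta> T \<omega>, yhat, z) \<in> ?feas"
      and min: "\<And>s. s \<in> ?feas \<Longrightarrow> \<not> ?obj s < ?obj (\<theta> T \<omega>, yhat, z)"
      by (auto simp: argmin_set_def is_arg_min_def)
    have "(\<Sum>i = 1..T. f (\<theta> T \<omega>) (\<xi> i \<omega>)) \<le> (\<Sum>i = 1..T. f t (\<xi> i \<omega>))" if "t \<in> \<Theta>" for t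
    proof -
      \<comment> \<open>Every parameter in \<open>\<Theta>\<close> extends to a feasible point, so
        \<open>\<theta> T \<omega>\<close> competes against all of them.\<close>
      have feas': "(t, \<lambda>i. \<Psi> t (X i \<omega>), \<lambda>i. \<zeta> (\<Psi> t (X i \<omega>))) \<in> ?feas"
        using that argmin[OF \<Psi>_D[OF that]] by (simp add: bilevel_feasible_def)
      show ?thesis
        using min[OF feas'] T unfolding obj[OF feas] obj[OF feas']
        by (simp add: not_less divide_le_cancel)
    qed
    then show ?thesis
      using feas by (auto simp: bilevel_feasible_def)
  qed
  \<comment> \<open>By \<open>expectation\<close> all objective values on \<open>\<Theta>\<close>
    are real, so the comparison of extended reals in \<open>argmin_set\<close> becomes one of
    integrals.\<close>
  have "S_opt = {t \<in> \<Theta>. \<forall>t'\<in>\<Theta>. (\<integral>p. f t p \<partial>N) \<le> (\<integral>p. f t' p \<partial>N)}"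
    unfolding S_opt argmin_set_def is_arg_min_def using expectation by (auto simp: not_less)
  moreover have "indep_vars (\<lambda>_. borel) \<xi> {1..}"
    using indep by (simp add: \<xi>_def [abs_def])
  moreover have "distr M borel (\<xi> t) = N" if "t \<ge> 1" for t
    using ident[OF that] by (simp add: N_def \<xi>_def [abs_def] \<xi>\<^sub>0_def [abs_def])
  ultimately show ?thesis
    by (intro argmin_consistency[where f = f, OF _ _ Theta f_cont h_int f_bound])
      (use solution in auto)
qed

end
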